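(* Let $Q:\mathcal A\to[0,1]$ be a fractional hitting-set for $\mathcal B$, and let $p\in[0,1]^{\mathcal X}$ be the probability vector (so $\sum_{j\in F_i}p_{i,j}=1$ for each $i$). In each of the following three cases, the Partial Resampling Algorithm (PRA) terminates with probability one in a configuration avoiding all bad-events. (a) Suppose that $\mu:\mathcal A\to[0,\infty)$ satisfies, for all $Y\in\mathcal A$, $$\mu(Y)\ \ge\ p^Y Q(Y)\sum_{\mathcal T\in \mathrm{NS}(Y)}\ \prod_{Y'\in\mathcal T}\mu(Y').$$ Then the expected number of resamplings is at most $\sum_{Y\in\mathcal A}\mu(Y)$. (b) Suppose that $\mu:\mathcal A\to[0,\infty)$ satisfies, for all $Y\in\mathcal A$, $$\mu(Y)\ \ge\ p^Y Q(Y)\Bigl(\prod_{Y'\sim Y}(1+\mu(Y'))\Bigr)\Bigl(1+\sum_{Y''\bowtie Y}\mu(Y'')\Bigr).$$ Then the expected number of resamplings is at most $\sum_{Y\in\mathcal A}\mu(Y)$. (c) Suppose that $p^YQ(Y)\le P$ for all $Y\in\mathcal A$; that for every supported $Y$ there are at most $D$ supported $Y'$ with $Y'\approx Y$ (here $Y'=Y$ is allowed and counted); and that $ePD\le 1$. Then the expected number of resamplings is at most $e\sum_{Y\in\mathcal A}p^YQ(Y)$.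
   Context: Variables $X_1,\dots,X_n$; variable $X_i$ takes values in a finite set $F_i$. An element is a pair $(i,j)$ with $i\in[n]$, $j\in F_i$; $\mathcal X$ is the set of all elements. $\mathcal A\subseteq 2^{\mathcal X}$ is the family of atomic sets: all non-empty sets $Y=\{(i_1,j_1),\dots,(i_k,j_k)\}$ with $i_1,\dots,i_k$ distinct and $j_\ell\in F_{i_\ell}$. $Y\in\mathcal A$ holds on a configuration $(X_1,\dots,X_n)$ if $X_i=j$ for all $(i,j)\in Y$. For a vector $\lambda$ indexed by $\mathcal X$, $\lambda^Y=\prod_{x\in Y}\lambda_x$. The set of bad-events is a subset $\mathcal B\subseteq\mathcal A$; a bad-event $B\in\mathcal B$ is true when $B$ holds on $X$. A function $Q:\mathcal A\to[0,1]$ is a fractional hitting-set for $\mathcal B$ if $\sum_{Y\subseteq B,\,Y\ne\emptyset}Q(Y)\ge1$ for every $B\in\mathcal B$. $Y\in\mathcal A$ is supported if $Q(Y)>0$. PRA: draw $X_1,\dots,X_n$ independently with $\Pr(X_i=j)=p_{i,j}$. While there is a true bad-event: select arbitrarily some true $B\in\mathcal B$; select exactly one subset $Y\subseteq B$ at random, a given $Y$ being chosen with probability $Q(Y)/\sum_{Z\subseteq B}Q(Z)$; for each $(i,j)\in Y$, draw a new value of $X_i$ independently from the distribution $p_{i,\cdot}$. Return $X$. Each iteration of the loop is one resampling. Relations on $\mathcal A$: $Y\sim Y'$ iff there are $i,j,j'$ with $(i,j)\in Y$ and $(i,j')\in Y'$ (so $Y\sim Y$). $Y\bowtie Y'$ iff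 $Y\not\sim Y'$ and there is $B\in\mathcal B$ with $Y,Y'\subseteq B$. $Y\approx Y'$ iff $Y\sim Y'$ or $Y\bowtie Y'$. For $Y\in\mathcal A$, a set $\mathcal T\subseteq\mathcal A$ is a neighbor-set for $Y$, written $\mathcal T\in\mathrm{NS}(Y)$, if: (1) every $Z\in\mathcal T$ satisfies $Z\approx Y$; (2) there are no distinct $Z,Z'\in\mathcal T$ with $Z\sim Z'$; (3) there is at most one $Z\in\mathcal T$ with $Z\bowtie Y$. (The empty set is allowed; empty products equal 1.) *)

theory Defs
  imports "HOL-Probability.Probability"
begin

text \<open>
  The variables are indexed by \<open>{1..n}\<close> and variable \<open>i\<close> ranges over \<open>F i\<close>; all value sets live
  in one type \<open>'v\<close>.  Configurations are functions that are \<open>undefined\<close> outside \<open>{1..n}\<close>.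
\<close>

type_synonym 'v elem = "nat \<times> 'v"
type_synonym 'v config = "nat \<Rightarrow> 'v"

definition elements :: "nat \<Rightarrow> (nat \<Rightarrow> 'v set) \<Rightarrow> 'v elem set" where
  "elements n F = Sigma {1..n} F"

definition atomic_sets :: "nat \<Rightarrow> (nat \<Rightarrow> 'v set) \<Rightarrow> 'v elem set set" where
  "atomic_sets n F = {Y. Y \<noteq> {} \<and> Y \<subseteq> elements n F \<and> inj_on fst Y}"

definition holds :: "'v elem set \<Rightarrow> 'v config \<Rightarrow> bool" where
  "holds Y X \<longleftrightarrow> (\<forall>(i, j)\<in>Y. X i = j)"

definition vpow :: "('v elem \<Rightarrow> real) \<Rightarrow> 'v elem set \<Rightarrow> real" where
  "vpow w Y = (\<Prod>x\<in>Y. w x)"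

text \<open>Since every bad-event is atomic, the non-empty subsets of \<open>B\<close> are themselves atomic.\<close>

definition nonempty_subsets :: "'a set \<Rightarrow> 'a set set" where
  "nonempty_subsets B = {Y. Y \<subseteq> B \<and> Y \<noteq> {}}"

definition fractional_hitting_set ::
  "nat \<Rightarrow> (nat \<Rightarrow> 'v set) \<Rightarrow> 'v elem set set \<Rightarrow> ('v elem set \<Rightarrow> real) \<Rightarrow> bool" where
  "fractional_hitting_set n F \<B> Q \<longleftrightarrow>
     (\<forall>Y\<in>atomic_sets n F. 0 \<le> Q Y \<and> Q Y \<le> 1) \<and>
     (\<forall>B\<in>\<B>. 1 \<le> (\<Sum>Y\<in>nonempty_subsets B. Q Y))"

definition probability_vector ::
  "nat \<Rightarrow> (nat \<Rightarrow> 'v set) \<Rightarrow> ('v elem \<Rightarrow> real) \<Rightarrow> bool" where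
  "probability_vector n F p \<longleftrightarrow>
     (\<forall>x\<in>elements n F. 0 \<le> p x \<and> p x \<le> 1) \<and>
     (\<forall>i\<in>{1..n}. (\<Sum>j\<in>F i. p (i, j)) = 1)"

definition supported :: "nat \<Rightarrow> (nat \<Rightarrow> 'v set) \<Rightarrow> ('v elem set \<Rightarrow> real) \<Rightarrow> 'v elem set set" where
  "supported n F Q = {Y\<in>atomic_sets n F. 0 < Q Y}"


subsection \<open>Relations on atomic sets and neighbor-sets\<close>

definition rel_sim :: "'v elem set \<Rightarrow> 'v elem set \<Rightarrow> bool" where
  "rel_sim Y Y' \<longleftrightarrow> (\<exists>i j j'. (i, j) \<in> Y \<and> (i, j') \<in> Y')"

definition rel_bowtie :: "'v elem set set \<Rightarrow> 'v elem set \<Rightarrow> 'v elem set \<Rightarrow> bool" where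
  "rel_bowtie \<B> Y Y' \<longleftrightarrow> \<not> rel_sim Y Y' \<and> (\<exists>B\<in>\<B>. Y \<subseteq> B \<and> Y' \<subseteq> B)"

definition rel_approx :: "'v elem set set \<Rightarrow> 'v elem set \<Rightarrow> 'v elem set \<Rightarrow> bool" where
  "rel_approx \<B> Y Y' \<longleftrightarrow> rel_sim Y Y' \<or> rel_bowtie \<B> Y Y'"

definition neighbor_sets ::
  "nat \<Rightarrow> (nat \<Rightarrow> 'v set) \<Rightarrow> 'v elem set set \<Rightarrow> 'v elem set \<Rightarrow> 'v elem set set set" where
  "neighbor_sets n F \<B> Y =
     {T. T \<subseteq> atomic_sets n F \<and>
         (\<forall>Z\<in>T. rel_approx \<B> Z Y) \<and>
         \<not> (\<exists>Z\<in>T. \<exists>Z'\<in>T. Z \<noteq> Z' \<and> rel_sim Z Z') \<and>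
         (\<forall>Z\<in>T. \<forall>Z'\<in>T. rel_bowtie \<B> Z Y \<and> rel_bowtie \<B> Z' Y \<longrightarrow> Z = Z')}"


subsection \<open>The Partial Resampling Algorithm\<close>

definition value_pmf :: "(nat \<Rightarrow> 'v set) \<Rightarrow> ('v elem \<Rightarrow> real) \<Rightarrow> nat \<Rightarrow> 'v pmf" where
  "value_pmf F p i = embed_pmf (\<lambda>j. if j \<in> F i then p (i, j) else 0)"

definition initial_pmf :: "nat \<Rightarrow> (nat \<Rightarrow> 'v set) \<Rightarrow> ('v elem \<Rightarrow> real) \<Rightarrow> 'v config pmf" where
  "initial_pmf n F p = Pi_pmf {1..n} undefined (value_pmf F p)"

definition subset_pmf :: "('v elem set \<Rightarrow> real) \<Rightarrow> 'v elem set \<Rightarrow> 'v elem set pmf" where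
  "subset_pmf Q B =
     embed_pmf (\<lambda>Y. if Y \<in> nonempty_subsets B then Q Y / (\<Sum>Z\<in>nonempty_subsets B. Q Z) else 0)"

definition resample_pmf ::
  "(nat \<Rightarrow> 'v set) \<Rightarrow> ('v elem \<Rightarrow> real) \<Rightarrow> 'v elem set \<Rightarrow> 'v config \<Rightarrow> 'v config pmf" where
  "resample_pmf F p Y X =
     map_pmf (\<lambda>X'. override_on X X' (fst ` Y)) (Pi_pmf (fst ` Y) undefined (value_pmf F p))"

text \<open>
  A history lists, most recent first, the resamplings performed so far: the configuration
  before the resampling, the selected bad-event, and the subset of it that was resampled.

  The arbitrary choice of a true bad-event is modelled by a selection rule, which may depend on
  the current configuration and the whole history and may be randomized; deterministic rules
  are those of the form \<open>\<lambda>X h. return_pmf (s X h)\<close>.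
\<close>

type_synonym 'v history = "('v config \<times> 'v elem set \<times> 'v elem set) list"
type_synonym 'v selector = "'v config \<Rightarrow> 'v history \<Rightarrow> 'v elem set pmf"

definition valid_selector :: "'v elem set set \<Rightarrow> 'v selector \<Rightarrow> bool" where
  "valid_selector \<B> sel \<longleftrightarrow>
     (\<forall>X h. (\<exists>B\<in>\<B>. holds B X) \<longrightarrow> set_pmf (sel X h) \<subseteq> {B\<in>\<B>. holds B X})"

text \<open>
  As the least fixed point in the sub-probability monad, the loop assigns to \<open>Some (X, h)\<close> the
  probability of stopping with configuration \<open>X\<close> after the resamplings \<open>h\<close>, and to \<open>None\<close> the
  probability of running forever.
\<close>

partial_function (spmf) pra_loop ::
  "(nat \<Rightarrow> 'v set) \<Rightarrow> ('v elem \<Rightarrow> real) \<Rightarrow> ('v elem set \<Rightarrow> real) \<Rightarrow> 'v elem set set \<Rightarrow>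
   'v selector \<Rightarrow> 'v config \<Rightarrow> 'v history \<Rightarrow> ('v config \<times> 'v history) spmf" where
  "pra_loop F p Q \<B> sel X h =
     (if \<exists>B\<in>\<B>. holds B X then
        bind_pmf (sel X h) (\<lambda>B.
        bind_pmf (subset_pmf Q B) (\<lambda>Y.
        bind_pmf (resample_pmf F p Y X) (\<lambda>X'.
          pra_loop F p Q \<B> sel X' ((X, B, Y) # h))))
      else return_spmf (X, h))"

definition pra ::
  "nat \<Rightarrow> (nat \<Rightarrow> 'v set) \<Rightarrow> ('v elem \<Rightarrow> real) \<Rightarrow> ('v elem set \<Rightarrow> real) \<Rightarrow> 'v elem set set \<Rightarrow>
   'v selector \<Rightarrow> ('v config \<times> 'v history) spmf" where
  "pra n F p Q \<B> sel = bind_pmf (initial_pmf n F p) (\<lambda>X. pra_loop F p Q \<B> sel X [])"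

definition as_terminates_avoiding ::
  "'v elem set set \<Rightarrow> ('v config \<times> 'v history) spmf \<Rightarrow> bool" where
  "as_terminates_avoiding \<B> R \<longleftrightarrow>
     (AE r in measure_pmf R. \<exists>X h. r = Some (X, h) \<and> (\<forall>B\<in>\<B>. \<not> holds B X))"

text \<open>A run that never stops performs infinitely many resamplings.\<close>

definition num_resamplings :: "('v config \<times> 'v history) option \<Rightarrow> ennreal" where
  "num_resamplings r = (case r of None \<Rightarrow> \<infinity> | Some (X, h) \<Rightarrow> of_nat (length h))"

definition expected_resamplings :: "('v config \<times> 'v history) spmf \<Rightarrow> ennreal" where
  "expected_resamplings R = (\<integral>\<^sup>+ r. num_resamplings r \<partial>measure_pmf R)"


subsection \<open>The distributions are well defined\<close>

lemma pmf_value_pmf: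
  assumes "\<And>i. i \<in> {1..n} \<Longrightarrow> finite (F i)" "probability_vector n F p" "i \<in> {1..n}"
  shows "pmf (value_pmf F p i) j = (if j \<in> F i then p (i, j) else 0)"
proof -
  let ?f = "\<lambda>j. if j \<in> F i then p (i, j) else 0"
  have nn: "0 \<le> ?f j" for j
    using assms by (auto simp: probability_vector_def elements_def)
  have "(\<integral>\<^sup>+ j. ennreal (?f j) \<partial>count_space UNIV)
      = (\<integral>\<^sup>+ j. ennreal (p (i, j)) * indicator (F i) j \<partial>count_space UNIV)"
    by (intro nn_integral_cong) (auto simp: indicator_def)
  also have "\<dots> = (\<integral>\<^sup>+ j. ennreal (p (i, j)) \<partial>count_space (F i))"
    by (simp add: nn_integral_count_space_indicator)
  also have "\<dots> = (\<Sum>j\<in>F i. ennreal (p (i, j)))"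
    using assms by (intro nn_integral_count_space_finite) auto
  also have "\<dots> = ennreal (\<Sum>j\<in>F i. p (i, j))"
    using assms by (intro sum_ennreal) (auto simp: probability_vector_def elements_def)
  also have "\<dots> = 1"
    using assms by (auto simp: probability_vector_def)
  finally show ?thesis
    unfolding value_pmf_def using nn by (subst pmf_embed_pmf) auto
qed

lemma pmf_subset_pmf:
  assumes "\<And>i. i \<in> {1..n} \<Longrightarrow> finite (F i)" "\<B> \<subseteq> atomic_sets n F"
    and "fractional_hitting_set n F \<B> Q" "B \<in> \<B>"
  shows "pmf (subset_pmf Q B) Y =
    (if Y \<in> nonempty_subsets B then Q Y / (\<Sum>Z\<in>nonempty_subsets B. Q Z) else 0)"
proof -
  let ?N = "nonempty_subsets B" and ?S = "\<Sum>Z\<in>nonempty_subsets B. Q Z"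
  let ?f = "\<lambda>Y. if Y \<in> ?N then Q Y / ?S else 0"
  have B: "B \<subseteq> elements n F" "inj_on fst B"
    using assms by (auto simp: atomic_sets_def)
  have "finite B"
    using B(1) assms(1) by (rule_tac finite_subset) (auto simp: elements_def)
  then have fin: "finite ?N"
    by (auto simp: nonempty_subsets_def)
  have S: "1 \<le> ?S"
    using assms by (auto simp: fractional_hitting_set_def)
  have "?N \<subseteq> atomic_sets n F"
    using B by (auto simp: nonempty_subsets_def atomic_sets_def intro: inj_on_subset)
  then have Q: "0 \<le> Q Z" if "Z \<in> ?N" for Z
    using assms(3) that by (auto simp: fractional_hitting_set_def)
  have nn: "0 \<le> ?f Z" for Z
    using Q S by auto
  have "(\<integral>\<^sup>+ Z. ennreal (?f Z) \<partial>count_space UNIV)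
      = (\<integral>\<^sup>+ Z. ennreal (Q Z / ?S) * indicator ?N Z \<partial>count_space UNIV)"
    by (intro nn_integral_cong) (auto simp: indicator_def)
  also have "\<dots> = (\<integral>\<^sup>+ Z. ennreal (Q Z / ?S) \<partial>count_space ?N)"
    by (simp add: nn_integral_count_space_indicator)
  also have "\<dots> = (\<Sum>Z\<in>?N. ennreal (Q Z / ?S))"
    using fin by (intro nn_integral_count_space_finite)
  also have "\<dots> = ennreal (\<Sum>Z\<in>?N. Q Z / ?S)"
    using Q S by (intro sum_ennreal) auto
  also have "\<dots> = 1"
    using S by (simp flip: sum_divide_distrib)
  finally show ?thesis
    unfolding subset_pmf_def using nn by (subst pmf_embed_pmf) auto
qed

end

theory Submission
  imports Defs
begin

text \<open>
  Each resampling \<open>Y\<close> at time \<open>t\<close> is explained by a witness tree. Its root is \<open>Y\<close>; going back in time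
  from \<open>t\<close>, every earlier resampled set \<open>Z\<close> that is related to a node of the current tree is hung as
  deep as possible below such a node. A node accepts any number of children that share a variable
  with it (these are pairwise unrelated by \<open>rel_sim\<close>, since otherwise one would sit below the other)
  but at most one child that is related to it by \<open>rel_bowtie\<close>. Hence the children of a node
  labelled \<open>Y\<close> always form a neighbor-set of \<open>Y\<close>.

  The number of resamplings is the number of witness trees that occur, so it suffices to bound, for
  each tree, the expected number of its occurrences by the product of \<open>p\<^sup>Y Q(Y)\<close> over its nodes.
  These products are then summed over all trees by recursion on the depth: a node labelled \<open>Y\<close>
  contributes \<open>p\<^sup>Y Q(Y)\<close> times a sum over its possible neighbor-sets of children, so the hypothesis
  on \<open>\<mu>\<close> bounds the total weight of the trees rooted at \<open>Y\<close> by \<open>\<mu>(Y)\<close>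
  (\<open>sum_weight_trees_from_le\<close>).

  The bound for one tree (\<open>expected_count_le_likelihood\<close>) is proved for an arbitrary starting
  configuration \<open>X\<close>, by induction on the number of steps. The likelihood of a tree charges \<open>Q(Y)\<close> for
  each node; for each variable, the deepest node that mentions it, which is the earliest one, must
  agree with \<open>X\<close>, and the other nodes that mention it are charged \<open>p\<close>, because the variable has
  been redrawn below them. Averaging over \<open>X\<close> turns the likelihood into the product of the
  \<open>p\<^sup>Y Q(Y)\<close>. Now let the first step select \<open>B\<close>. If no subset of \<open>B\<close> can have been the last one hung on
  the tree, then a drawn \<open>Y\<close> leaves the tree unaffected only when it shares no variable with it, and
  then the likelihood does not change on average. If some \<open>Y \<subseteq> B\<close> can have been hung last, it is the
  only one (\<open>hang_unique\<close>), and every other subset of \<open>B\<close> would necessarily have changed the tree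
  (\<open>related_hangs_below\<close>); so \<open>Y\<close> is drawn, which has probability at most \<open>Q(Y)\<close> and is the factor charged
  for that node. Two subsets of the same bad-event are always related; this is exactly what the
  relation \<open>rel_bowtie\<close> is made for, and it is why selecting bad-events adversarially many times
  does not give a set \<open>Y\<close> additional chances to be drawn.

  The second hypothesis implies the first one by splitting a neighbor-set into its \<open>rel_sim\<close> part
  and its at most one \<open>rel_bowtie\<close> element. The symmetric criterion is the first one
  for \<open>\<mu>(Y) = e p\<^sup>Y Q(Y)\<close>. The loop itself is reached by truncation: all bounds hold for the first \<open>m\<close>
  iterations, uniformly in \<open>m\<close>.
\<close>

section \<open>Witness trees and their growth\<close>

text \<open>
  The combinatorics of witness trees uses only these properties of the two relations. In the
  application \<open>A\<close> is the family of atomic sets, \<open>sim\<close> is \<open>rel_sim\<close> and \<open>bow\<close> is \<open>rel_bowtie\<close>.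
\<close>

locale neighborhood =
  fixes A :: "'a set" and sim bow :: "'a \<Rightarrow> 'a \<Rightarrow> bool"
  assumes finite_A: "finite A"
    and sim_refl: "Y \<in> A \<Longrightarrow> sim Y Y"
    and sim_sym: "sim Y Z \<Longrightarrow> sim Z Y"
    and bow_sym: "bow Y Z \<Longrightarrow> bow Z Y"
    and bow_not_sim: "bow Y Z \<Longrightarrow> \<not> sim Y Z"
begin

abbreviation approx :: "'a \<Rightarrow> 'a \<Rightarrow> bool" where
  "approx Y Z \<equiv> sim Y Z \<or> bow Y Z"

text \<open>
  A tree is encoded as the list of its levels, root first. An entry \<open>(Z, v)\<close> of a level is a
  node labelled \<open>Z\<close> whose parent is the node labelled \<open>v\<close> one level above. Labels of one level are
  pairwise not \<open>sim\<close>, hence distinct, so a label identifies its node within the level. The parents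
  must be recorded: from the labels of the levels alone, one could not tell which of two related
  nodes of a level is a leaf, and the node that was hung last would not be unique.
\<close>

definition layer :: "('a \<times> 'a) set \<Rightarrow> bool" where
  "layer I \<longleftrightarrow> I \<subseteq> A \<times> A \<and> (\<forall>a\<in>I. \<forall>b\<in>I. sim (fst a) (fst b) \<longrightarrow> a = b)"

text \<open>
  Level \<open>J\<close> can follow level \<open>I\<close>: the children of each node form a neighbor-set of its label, apart
  from the condition on \<open>sim\<close>, which \<open>layer\<close> imposes on the whole level.
\<close>

definition links :: "('a \<times> 'a) set \<Rightarrow> ('a \<times> 'a) set \<Rightarrow> bool" where
  "links I J \<longleftrightarrow> (\<forall>a\<in>J. snd a \<in> fst ` I \<and> approx (fst a) (snd a)) \<and>
     (\<forall>a\<in>J. \<forall>b\<in>J. snd a = snd b \<and> bow (fst a) (snd a) \<and> bow (fst b) (snd b) \<longrightarrow> a = b)"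

definition top_layer :: "('a \<times> 'a) set list \<Rightarrow> ('a \<times> 'a) set" where
  "top_layer L = (case L of [] \<Rightarrow> {} | J # _ \<Rightarrow> J)"

fun tree :: "('a \<times> 'a) set list \<Rightarrow> bool" where
  "tree [] = True"
| "tree (I # L) = (layer I \<and> I \<noteq> {} \<and> links I (top_layer L) \<and> tree L)"

definition labels :: "('a \<times> 'a) set list \<Rightarrow> 'a set" where
  "labels L = fst ` \<Union> (set L)"

text \<open>
  Adds a node labelled \<open>Y\<close> as deep as possible. Which of several possible parents on the chosen level
  is taken does not matter, but it has to be a function of the tree.
\<close>

fun hang :: "'a \<Rightarrow> ('a \<times> 'a) set list \<Rightarrow> ('a \<times> 'a) set list option" where
  "hang Y [] = None"
| "hang Y (I # L) =
     (case hang Y L of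
        Some L' \<Rightarrow> Some (I # L')
      | None \<Rightarrow>
          if \<exists>v. links I (insert (Y, v) (top_layer L))
          then Some (I # insert (Y, SOME v. links I (insert (Y, v) (top_layer L))) (top_layer L) # tl L)
          else None)"

text \<open>
  The empty list stands for a tree whose root still lies in the future; the first set it meets
  becomes the root. The root is given itself as a formal parent.
\<close>

definition extend :: "'a \<Rightarrow> ('a \<times> 'a) set list \<Rightarrow> ('a \<times> 'a) set list" where
  "extend Y L =
     (if L = [] then [{(Y, Y)}] else case hang Y L of None \<Rightarrow> L | Some L' \<Rightarrow> L')"

text \<open>
  The set \<open>Y\<close> is the last one added to \<open>t\<close>. In contrast to \<open>extend\<close>, this excludes that \<open>s\<close> ignores \<open>Y\<close>.
\<close>

definition grows :: "'a \<Rightarrow> ('a \<times> 'a) set list \<Rightarrow> ('a \<times> 'a) set list \<Rightarrow> bool" where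
  "grows Y s t \<longleftrightarrow> (s = [] \<and> t = [{(Y, Y)}]) \<or> hang Y s = Some t"

lemma top_layer_simps [simp]: "top_layer [] = {}" "top_layer (J # L) = J"
  by (auto simp: top_layer_def)

lemma labels_simps [simp]: "labels [] = {}" "labels (I # L) = fst ` I \<union> labels L"
  by (auto simp: labels_def)

lemma links_empty [simp]: "links I {}"
  by (auto simp: links_def)

lemma links_mono: "links I J \<Longrightarrow> I \<subseteq> I' \<Longrightarrow> links I' J"
  unfolding links_def by (meson image_mono subsetD)

lemma top_layer_tree:
  assumes "tree L"
  shows "layer (top_layer L)" "links (top_layer L) (top_layer (tl L))" "tree (tl L)"
  using assms by (cases L; auto simp: layer_def)+

lemma labels_top_layer: "fst ` top_layer L \<subseteq> labels L" "labels L = fst ` top_layer L \<union> labels (tl L)"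
  by (cases L; auto)+

lemma finite_layer: "layer I \<Longrightarrow> finite I"
  unfolding layer_def using finite_A finite_subset by blast

lemma hang_cases:
  assumes "hang Y (I # L) = Some t"
  obtains (deep) L' where "t = I # L'" "hang Y L = Some L'"
  | (here) v where "t = I # insert (Y, v) (top_layer L) # tl L" "hang Y L = None"
      "links I (insert (Y, v) (top_layer L))"
proof (cases "hang Y L")
  case None
  then obtain v where "links I (insert (Y, v) (top_layer L))"
    using assms by (auto split: if_splits)
  then have "links I (insert (Y, SOME v. links I (insert (Y, v) (top_layer L))) (top_layer L))"
    by (rule someI)
  with None assms show ?thesis
    using here by (auto split: if_splits)
qed (use assms deep in auto)

lemma hang_Some_shape:
  assumes "hang Y s = Some t"
  shows "s \<noteq> []" "t \<noteq> []" "tl t \<noteq> []" "hd t = hd s"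
proof -
  have "s \<noteq> [] \<and> t \<noteq> [] \<and> tl t \<noteq> [] \<and> hd t = hd s"
    using assms
  proof (induction s arbitrary: t)
    case (Cons I L)
    from Cons.prems show ?case
      by (cases rule: hang_cases) (use Cons.IH in auto)
  qed auto
  then show "s \<noteq> []" "t \<noteq> []" "tl t \<noteq> []" "hd t = hd s" by auto
qed

lemma hang_Cons_mono: "hang Y L \<noteq> None \<Longrightarrow> hang Y (I # L) \<noteq> None"
  by (auto split: option.splits)

lemma hang_tl_mono: "hang Y (tl L) \<noteq> None \<Longrightarrow> hang Y L \<noteq> None"
  by (cases L) (auto split: option.splits)

text \<open>
  A node that is \<open>sim\<close> to \<open>Y\<close> accepts \<open>Y\<close> as a child unless its children include a set \<open>sim\<close> to \<open>Y\<close>,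
  and then \<open>Y\<close> can go deeper. So only sets that share no variable with a tree are left out.
\<close>

lemma not_hung_not_sim:
  assumes "tree L" "hang Y L = None" "Y \<in> A" "Z \<in> labels L"
  shows "\<not> sim Y Z"
  using assms
proof (induction L)
  case (Cons I L)
  have hL: "hang Y L = None"
    using Cons.prems(2) hang_Cons_mono by blast
  have no: "\<not> links I (insert (Y, v) (top_layer L))" for v
    using Cons.prems(2) hL by (auto split: if_splits)
  have below: "Z \<notin> labels L" if "sim Y Z"
    using Cons.IH Cons.prems(1,3) that hL by auto
  have l: "links I (top_layer L)"
    using Cons.prems by simp
  have "Z \<notin> fst ` I" if s: "sim Y Z"
  proof
    assume Z: "Z \<in> fst ` I"
    have "\<not> bow Y Z"
      using s bow_not_sim by blast
    then have "links I (insert (Y, Z) (top_layer L))"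
      using l Z s by (auto simp: links_def)
    with no show False by blast
  qed
  with below show ?case
    using Cons.prems(4) by auto
qed auto

lemma hang_tree:
  assumes "hang Y s = Some t" "tree s" "Y \<in> A"
  shows "tree t" "labels t = insert Y (labels s)"
proof -
  have "tree t \<and> labels t = insert Y (labels s)"
    using assms
  proof (induction s arbitrary: t)
    case (Cons I L)
    from Cons.prems(1) show ?case
    proof (cases rule: hang_cases)
      case (deep L')
      then have "top_layer L' = top_layer L"
        using hang_Some_shape[of Y L L'] by (cases L; cases L') auto
      with deep Cons show ?thesis by auto
    next
      case (here v)
      let ?J = "insert (Y, v) (top_layer L)"
      have L: "tree L" "layer (top_layer L)" "layer I"
        using Cons.prems top_layer_tree by auto
      have ns: "\<not> sim Y Z" "\<not> sim Z Y" if "Z \<in> fst ` top_layer L" for Z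
        using not_hung_not_sim[OF L(1) here(2) \<open>Y \<in> A\<close>] that labels_top_layer sim_sym by blast+
      have v: "v \<in> fst ` I"
        using here(3) by (auto simp: links_def)
      then have "v \<in> A"
        using L(3) by (auto simp: layer_def)
      then have "?J \<subseteq> A \<times> A"
        using L(2) \<open>Y \<in> A\<close> by (simp add: layer_def)
      moreover have "\<forall>a\<in>?J. \<forall>b\<in>?J. sim (fst a) (fst b) \<longrightarrow> a = b"
        using L(2) ns by (simp add: layer_def)
      ultimately have "layer ?J"
        by (simp add: layer_def)
      moreover have "links ?J (top_layer (tl L))"
        using top_layer_tree(2)[OF L(1)] by (rule links_mono) auto
      ultimately show ?thesis
        using here Cons.prems top_layer_tree(3)[OF L(1)] labels_top_layer(2)[of L] by auto
    qed
  qed auto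
  then show "tree t" "labels t = insert Y (labels s)" by auto
qed

text \<open>
  A node without children accepts every related set: its place for a \<open>bow\<close> child is still free.
\<close>

lemma fresh_leaf_hangs:
  assumes "links K (top_layer R)" "Y \<notin> fst ` K" "approx Z Y"
  shows "hang Z (insert (Y, a) K # R) \<noteq> None"
proof
  assume none: "hang Z (insert (Y, a) K # R) = None"
  have "snd b \<noteq> Y" if "b \<in> top_layer R" for b
    using that assms(1,2) by (auto simp: links_def)
  then have "links (insert (Y, a) K) (insert (Z, Y) (top_layer R))"
    using assms by (auto simp: links_def)
  with none show False
    by (auto split: option.splits if_splits)
qed

text \<open>
  The node hung last is a leaf, so a set related to its label can be hung below it, strictly deeper
  than that node. As that node is not the root, a parent is found among the levels below the root.
\<close>

lemma related_hangs_below: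
  assumes "hang Y s = Some t" "tree s" "Y \<in> A" "approx Z Y"
  shows "hang Z (tl t) \<noteq> None"
  using assms
proof (induction s arbitrary: t)
  case (Cons I L)
  from Cons.prems(1) show ?case
  proof (cases rule: hang_cases)
    case (deep L')
    then show ?thesis
      using Cons hang_tl_mono[of Z L'] by auto
  next
    case (here v)
    have L: "tree L"
      using Cons.prems by simp
    have "Y \<notin> fst ` top_layer L"
      using not_hung_not_sim[OF L here(2) \<open>Y \<in> A\<close>] labels_top_layer(1) sim_refl \<open>Y \<in> A\<close> by blast
    then show ?thesis
      using fresh_leaf_hangs[OF top_layer_tree(2)[OF L], of Y Z v] here Cons.prems by simp
  qed
qed auto

text \<open>
  Two related sets cannot both be the last one hung on the same tree: each of them would have to lie
  strictly deeper than the other. On a common level, both would be leaves, and the one hung second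
  would have been placed below the first.
\<close>

lemma hang_unique:
  assumes "hang Y s = Some t" "hang Z s' = Some t" "tree s" "tree s'" "Y \<in> A" "Z \<in> A" "approx Z Y"
  shows "Y = Z \<and> s = s'"
  using assms
proof (induction s arbitrary: s' t)
  case (Cons I L)
  obtain L' where s': "s' = I # L'"
    using hang_Some_shape[OF Cons.prems(1)] hang_Some_shape[OF Cons.prems(2)] by (cases s') auto
  have L: "tree L" and L': "tree L'"
    using Cons.prems s' by auto
  have aYZ: "approx Y Z"
    using Cons.prems(7) sim_sym bow_sym by blast
  note hZ = Cons.prems(2)[unfolded s']
  from Cons.prems(1) show ?case
  proof (cases rule: hang_cases)
    case (deep M)
    from hZ show ?thesis
    proof (cases rule: hang_cases)
      case (deep M')
      with \<open>t = I # M\<close> \<open>hang Y L = Some M\<close> Cons L L' s' show ?thesis by auto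
    next
      case (here v)
      then have M: "M = insert (Z, v) (top_layer L') # tl L'"
        using \<open>t = I # M\<close> by simp
      then have "hang Z (tl L') \<noteq> None"
        using related_hangs_below[OF \<open>hang Y L = Some M\<close> L] Cons.prems by simp
      then show ?thesis
        using here hang_tl_mono by blast
    qed
  next
    case (here v)
    note hereY = here
    from hZ show ?thesis
    proof (cases rule: hang_cases)
      case (deep M)
      then have M: "M = insert (Y, v) (top_layer L) # tl L"
        using hereY by simp
      then have "hang Y (tl L) \<noteq> None"
        using related_hangs_below[OF deep(2) L' \<open>Z \<in> A\<close> aYZ] by simp
      then show ?thesis
        using hereY hang_tl_mono by blast
    next
      case (here w)
      have eq: "insert (Y, v) (top_layer L) = insert (Z, w) (top_layer L')" "tl L = tl L'"
        using hereY here by auto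
      have nY: "Y \<notin> fst ` top_layer L"
        using not_hung_not_sim[OF L hereY(2) \<open>Y \<in> A\<close>] labels_top_layer(1) sim_refl \<open>Y \<in> A\<close> by blast
      have nZ: "Z \<notin> fst ` top_layer L'"
        using not_hung_not_sim[OF L' here(2) \<open>Z \<in> A\<close>] labels_top_layer(1) sim_refl \<open>Z \<in> A\<close> by blast
      show ?thesis
      proof (cases "Y = Z")
        case True
        have "v = w"
          using eq(1) nZ True by (metis Pair_inject fst_conv image_eqI insertI1 insertE)
        then have "top_layer L = top_layer L'"
          using eq(1) nY nZ True by (metis fst_conv image_eqI insert_ident)
        then have "L = L'"
          using eq(2) L L' by (cases L; cases L') auto
        then show ?thesis
          using True s' by simp
      next
        case False
        \<comment> \<open>No node of the next level has parent \<open>Y\<close> or \<open>Z\<close>, so the level without both still carries it.\<close>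
        define K where "K = top_layer L - {(Z, w)}"
        have Zin: "(Z, w) \<in> top_layer L"
          using eq(1) False by (metis Pair_inject insertE insertI1)
        have tl: "top_layer L = insert (Z, w) K"
          using Zin by (auto simp: K_def)
        have tl': "top_layer L' = insert (Y, v) K"
        proof -
          have "insert (Z, w) (insert (Y, v) K) = insert (Z, w) (top_layer L')"
            using eq(1) tl by (simp add: insert_commute)
          moreover have "(Z, w) \<notin> insert (Y, v) K"
            using False by (simp add: K_def)
          moreover have "(Z, w) \<notin> top_layer L'"
            using nZ by force
          ultimately show ?thesis
            using insert_ident by metis
        qed
        have "links (insert (Z, w) K) (top_layer (tl L))" "links (insert (Y, v) K) (top_layer (tl L))"
          using top_layer_tree(2)[OF L] top_layer_tree(2)[OF L'] tl tl' eq(2) by auto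
        moreover have "Z \<notin> fst ` K" "Y \<notin> fst ` K"
          using nY nZ tl tl' by auto
        ultimately have "links K (top_layer (tl L))"
          using False by (auto simp: links_def)
        then have "hang Y (insert (Z, w) K # tl L) \<noteq> None"
          using fresh_leaf_hangs \<open>Z \<notin> fst ` K\<close> aYZ by blast
        moreover have "L = insert (Z, w) K # tl L"
          using tl Zin by (cases L) auto
        ultimately show ?thesis
          using hereY by metis
      qed
    qed
  qed
qed auto

lemma grows_unique:
  assumes "grows Y s t" "grows Z s' t" "tree s" "tree s'" "Y \<in> A" "Z \<in> A" "approx Z Y"
  shows "Y = Z" "s = s'"
proof -
  have "Y = Z \<and> s = s'"
  proof (cases "tl t = []")
    case True
    then have "hang V r \<noteq> Some t" for V r
      using hang_Some_shape(3) by blast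
    then show ?thesis
      using assms(1,2) by (simp add: grows_def)
  next
    case False
    then show ?thesis
      using assms hang_unique[of Y s t Z s'] by (auto simp: grows_def)
  qed
  then show "Y = Z" "s = s'" by auto
qed

lemma grows_then_related_hangs:
  assumes "grows Y s t" "tree s" "Y \<in> A" "approx Z Y"
  shows "hang Z t \<noteq> None"
proof (cases "hang Y s")
  case None
  then show ?thesis
    using assms(1,4) fresh_leaf_hangs[of "{}" "[]" Y Z Y] by (simp add: grows_def del: hang.simps)
next
  case (Some t')
  then have "hang Y s = Some t"
    using assms(1) by (auto simp: grows_def)
  then show ?thesis
    using assms related_hangs_below[of Y s t Z] hang_tl_mono[of Z t] by blast
qed

lemma extend_eq_iff:
  "extend Y s = t \<longleftrightarrow> grows Y s t \<or> s \<noteq> [] \<and> s = t \<and> hang Y s = None"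
proof (cases "s = []")
  case False
  then show ?thesis
    by (cases "hang Y s") (auto simp: extend_def grows_def)
qed (auto simp: extend_def grows_def)

lemma grows_tree:
  assumes "grows Y s t" "tree s" "Y \<in> A"
  shows "tree t" "labels t = insert Y (labels s)"
proof -
  have "tree [{(Y, Y)}]"
    using assms(3) by (simp add: layer_def)
  then show "tree t" "labels t = insert Y (labels s)"
    using assms hang_tree[of Y s t] by (auto simp: grows_def)
qed

end

section \<open>The total weight of the witness trees\<close>

context neighborhood
begin

definition nbr_sets :: "'a \<Rightarrow> 'a set set" where
  "nbr_sets Y = {T. T \<subseteq> A \<and> (\<forall>Z\<in>T. approx Z Y) \<and>
     \<not> (\<exists>Z\<in>T. \<exists>Z'\<in>T. Z \<noteq> Z' \<and> sim Z Z') \<and>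
     (\<forall>Z\<in>T. \<forall>Z'\<in>T. bow Z Y \<and> bow Z' Y \<longrightarrow> Z = Z')}"

fun weight :: "('a \<Rightarrow> ennreal) \<Rightarrow> ('a \<times> 'a) set list \<Rightarrow> ennreal" where
  "weight w [] = 1"
| "weight w (I # L) = (\<Prod>a\<in>I. w (fst a)) * weight w L"

definition trees_from :: "nat \<Rightarrow> ('a \<times> 'a) set \<Rightarrow> ('a \<times> 'a) set list set" where
  "trees_from m I = {t. tree t \<and> t \<noteq> [] \<and> hd t = I \<and> length t \<le> m}"

lemma finite_nbr_sets: "finite (nbr_sets Y)"
  by (rule finite_subset[of _ "Pow A"]) (auto simp: nbr_sets_def finite_A)

lemma finite_layers: "finite {J. layer J}"
  by (rule finite_subset[of _ "Pow (A \<times> A)"]) (auto simp: layer_def finite_A)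

lemma tree_layers: "tree t \<Longrightarrow> set t \<subseteq> {J. layer J}"
  by (induction t) auto

lemma finite_trees_from: "finite (trees_from m I)"
  by (rule finite_subset[OF _ finite_lists_length_le[OF finite_layers, of m]])
     (use tree_layers in \<open>auto simp: trees_from_def\<close>)

text \<open>
  A level below \<open>I\<close> is determined by the sets of children of the nodes of \<open>I\<close>, each of which is a
  neighbor-set; expanding the product of sums gives one term for every such choice.
\<close>

lemma sum_linked_layers_le:
  fixes M :: "'a \<Rightarrow> ennreal"
  assumes "layer I"
  shows "(\<Sum>J | layer J \<and> links I J. \<Prod>a\<in>J. M (fst a)) \<le> (\<Prod>a\<in>I. \<Sum>T\<in>nbr_sets (fst a). \<Prod>Z\<in>T. M Z)"
proof -
  let ?V = "fst ` I" and ?S = "{J. layer J \<and> links I J}"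
  define children where "children J = (\<lambda>v\<in>?V. {Z. (Z, v) \<in> J})" for J :: "('a \<times> 'a) set"
  have finV: "finite ?V"
    using finite_layer[OF assms] by simp
  have par: "snd a \<in> ?V" if "J \<in> ?S" "a \<in> J" for J a
    using that by (auto simp: links_def)
  have inj: "inj_on children ?S"
  proof (rule inj_onI)
    fix J J' assume J: "J \<in> ?S" "J' \<in> ?S" and eq: "children J = children J'"
    have "(Z, v) \<in> J \<longleftrightarrow> (Z, v) \<in> J'" for Z v
    proof (cases "v \<in> ?V")
      case True
      then have "{Z. (Z, v) \<in> J} = {Z. (Z, v) \<in> J'}"
        using fun_cong[OF eq, of v] by (simp add: children_def)
      then show ?thesis by blast
    next
      case False
      then show ?thesis
        using par[OF J(1), of "(Z, v)"] par[OF J(2), of "(Z, v)"] by auto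
    qed
    then show "J = J'" by auto
  qed
  have sub: "children ` ?S \<subseteq> PiE ?V nbr_sets"
  proof
    fix g assume "g \<in> children ` ?S"
    then obtain J where J: "layer J" "links I J" and g: "g = children J" by auto
    have "{Z. (Z, v) \<in> J} \<in> nbr_sets v" for v
    proof -
      have "Z = Z'" if "(Z, v) \<in> J" "(Z', v) \<in> J" "sim Z Z' \<or> bow Z v \<and> bow Z' v" for Z Z'
        using J that unfolding layer_def links_def by (metis fst_conv snd_conv)
      moreover have "Z \<in> A" "approx Z v" if "(Z, v) \<in> J" for Z
        using J that by (auto simp: layer_def links_def)
      ultimately show ?thesis
        unfolding nbr_sets_def by blast
    qed
    then show "g \<in> PiE ?V nbr_sets"
      unfolding g children_def by auto
  qed
  have prd: "(\<Prod>a\<in>J. M (fst a)) = (\<Prod>v\<in>?V. \<Prod>Z\<in>children J v. M Z)" if J: "J \<in> ?S" for J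
  proof -
    have fin: "finite J"
      using J finite_layer by auto
    have "(\<Prod>v\<in>?V. \<Prod>Z\<in>children J v. M Z) = (\<Prod>v\<in>?V. \<Prod>Z\<in>{Z. (Z, v) \<in> J}. M Z)"
      by (intro prod.cong) (auto simp: children_def)
    also have "\<dots> = (\<Prod>(v, Z)\<in>Sigma ?V (\<lambda>v. {Z. (Z, v) \<in> J}). M Z)"
      using finV fin by (intro prod.Sigma ballI finite_subset[of "{Z. (Z, _) \<in> J}" "fst ` J"]) (auto intro: rev_image_eqI)
    also have "\<dots> = (\<Prod>a\<in>J. M (fst a))"
      using par[OF J]
      by (intro prod.reindex_bij_witness[of _ "\<lambda>a. (snd a, fst a)" "\<lambda>a. (snd a, fst a)"]) auto
    finally show ?thesis ..
  qed
  have "(\<Sum>J\<in>?S. \<Prod>a\<in>J. M (fst a)) = (\<Sum>g\<in>children ` ?S. \<Prod>v\<in>?V. \<Prod>Z\<in>g v. M Z)"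
    by (subst sum.reindex[OF inj]) (use prd in simp)
  also have "\<dots> \<le> (\<Sum>g\<in>PiE ?V nbr_sets. \<Prod>v\<in>?V. \<Prod>Z\<in>g v. M Z)"
    by (intro sum_mono2 finite_PiE finV finite_nbr_sets sub) auto
  also have "\<dots> = (\<Prod>v\<in>?V. \<Sum>T\<in>nbr_sets v. \<Prod>Z\<in>T. M Z)"
    by (rule prod_sum_PiE[symmetric]) (auto intro: finV finite_nbr_sets)
  also have "\<dots> = (\<Prod>a\<in>I. \<Sum>T\<in>nbr_sets (fst a). \<Prod>Z\<in>T. M Z)"
  proof (rule trans[OF prod.reindex])
    show "inj_on fst I"
      using assms sim_refl unfolding layer_def inj_on_def by (metis mem_Sigma_iff prod.collapse subsetD)
  qed simp
  finally show ?thesis .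
qed

text \<open>
  Splitting off the root level reduces the depth: the trees below it are bounded by induction, and
  \<open>sum_linked_layers_le\<close> turns the sum over the next level into the sums over neighbor-sets that
  the hypothesis controls.
\<close>

lemma sum_weight_trees_from_le:
  fixes M w :: "'a \<Rightarrow> ennreal"
  assumes M: "\<And>Y. Y \<in> A \<Longrightarrow> w Y * (\<Sum>T\<in>nbr_sets Y. \<Prod>Z\<in>T. M Z) \<le> M Y"
    and "layer I"
  shows "(\<Sum>t\<in>trees_from m I. weight w t) \<le> (\<Prod>a\<in>I. M (fst a))"
  using \<open>layer I\<close>
proof (induction m arbitrary: I)
  case 0
  have "trees_from 0 I = {}"
    by (auto simp: trees_from_def)
  then show ?case by simp
next
  case (Suc m)
  let ?S = "{J. layer J \<and> links I J \<and> J \<noteq> {}}" and ?w = "\<Prod>a\<in>I. w (fst a)"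
  let ?R = "{J. layer J \<and> links I J}"
  have finS: "finite ?S" "finite ?R"
    by (rule finite_subset[OF _ finite_layers]; auto)+
  have "trees_from (Suc m) I \<subseteq> insert [I] (\<Union>J\<in>?S. (#) I ` trees_from m J)"
  proof
    fix t assume t: "t \<in> trees_from (Suc m) I"
    then obtain L where L: "t = I # L" "length L \<le> m" "tree t"
      by (cases t) (auto simp: trees_from_def)
    show "t \<in> insert [I] (\<Union>J\<in>?S. (#) I ` trees_from m J)"
    proof (cases L)
      case (Cons J L')
      with L have "J \<in> ?S" "L \<in> trees_from m J"
        by (auto simp: trees_from_def)
      with L(1) show ?thesis by blast
    qed (use L in simp)
  qed
  then have "(\<Sum>t\<in>trees_from (Suc m) I. weight w t)
      \<le> (\<Sum>t\<in>insert [I] (\<Union>J\<in>?S. (#) I ` trees_from m J). weight w t)"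
    using finS finite_trees_from by (intro sum_mono2) auto
  also have "\<dots> \<le> weight w [I] + (\<Sum>t\<in>(\<Union>J\<in>?S. (#) I ` trees_from m J). weight w t)"
    using finS finite_trees_from by (subst sum.insert_if) auto
  also have "\<dots> = weight w [I] + (\<Sum>J\<in>?S. \<Sum>t\<in>(#) I ` trees_from m J. weight w t)"
    using finS(1) finite_trees_from
    by (intro arg_cong2[where f = "(+)"] sum.UNION_disjoint) (auto simp: trees_from_def)
  also have "\<dots> = ?w * (1 + (\<Sum>J\<in>?S. \<Sum>t\<in>trees_from m J. weight w t))"
    by (simp add: sum.reindex distrib_left sum_distrib_left)
  also have "\<dots> \<le> ?w * (1 + (\<Sum>J\<in>?S. \<Prod>a\<in>J. M (fst a)))"
    using Suc.IH by (intro mult_left_mono add_left_mono sum_mono) auto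
  also have "1 + (\<Sum>J\<in>?S. \<Prod>a\<in>J. M (fst a)) = (\<Sum>J\<in>insert {} ?S. \<Prod>a\<in>J. M (fst a))"
    by (subst sum.insert[OF finS(1)]) simp_all
  also have "insert {} ?S = ?R"
    by (auto simp: layer_def)
  also have "?w * (\<Sum>J\<in>?R. \<Prod>a\<in>J. M (fst a))
      \<le> ?w * (\<Prod>a\<in>I. \<Sum>T\<in>nbr_sets (fst a). \<Prod>Z\<in>T. M Z)"
    by (intro mult_left_mono sum_linked_layers_le Suc.prems) auto
  also have "\<dots> = (\<Prod>a\<in>I. w (fst a) * (\<Sum>T\<in>nbr_sets (fst a). \<Prod>Z\<in>T. M Z))"
    by (simp add: prod.distrib)
  also have "\<dots> \<le> (\<Prod>a\<in>I. M (fst a))"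
    using Suc.prems by (intro prod_mono_ennreal M) (auto simp: layer_def)
  finally show ?case .
qed

end

section \<open>How likely a witness tree is\<close>

lemma nn_integral_pmf_le_const:
  assumes "\<And>x. x \<in> set_pmf M \<Longrightarrow> f x \<le> c"
  shows "(\<integral>\<^sup>+x. f x \<partial>measure_pmf M) \<le> c"
proof -
  have "(\<integral>\<^sup>+x. f x \<partial>measure_pmf M) \<le> (\<integral>\<^sup>+x. c \<partial>measure_pmf M)"
    by (intro nn_integral_mono_AE) (auto simp: AE_measure_pmf_iff assms)
  then show ?thesis
    by (simp add: measure_pmf.emeasure_space_1)
qed

locale pra_setting =
  fixes n :: nat and F :: "nat \<Rightarrow> 'v set" and p :: "'v elem \<Rightarrow> real"
    and Q :: "'v elem set \<Rightarrow> real" and \<B> :: "'v elem set set" and sel :: "'v selector"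
  assumes finite_values: "\<And>i. i \<in> {1..n} \<Longrightarrow> finite (F i)"
    and bad_atomic: "\<B> \<subseteq> atomic_sets n F"
    and hitting: "fractional_hitting_set n F \<B> Q"
    and prob_vec: "probability_vector n F p"
    and valid_sel: "valid_selector \<B> sel"
begin

lemma finite_elements: "finite (elements n F)"
  using finite_values by (auto simp: elements_def)

lemma rel_sim_iff: "rel_sim Y Z \<longleftrightarrow> fst ` Y \<inter> fst ` Z \<noteq> {}"
  by (force simp: rel_sim_def)

sublocale neighborhood "atomic_sets n F" rel_sim "rel_bowtie \<B>"
proof
  show "finite (atomic_sets n F)"
    by (rule finite_subset[of _ "Pow (elements n F)"]) (auto simp: atomic_sets_def finite_elements)
  show "rel_sim Y Y" if "Y \<in> atomic_sets n F" for Y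
    using that by (auto simp: rel_sim_iff atomic_sets_def)
  show "rel_sim Z Y" if "rel_sim Y Z" for Y Z
    using that by (auto simp: rel_sim_iff)
  show "rel_bowtie \<B> Z Y" if "rel_bowtie \<B> Y Z" for Y Z
    using that by (auto simp: rel_bowtie_def rel_sim_iff)
  show "\<not> rel_sim Y Z" if "rel_bowtie \<B> Y Z" for Y Z
    using that by (simp add: rel_bowtie_def)
qed

lemma atomic_finite: "Y \<in> atomic_sets n F \<Longrightarrow> finite Y"
  using finite_subset[OF _ finite_elements] by (auto simp: atomic_sets_def)

lemma atomic_vars: "Y \<in> atomic_sets n F \<Longrightarrow> fst ` Y \<subseteq> {1..n}"
  by (auto simp: atomic_sets_def elements_def)

lemma p_nonneg: "x \<in> elements n F \<Longrightarrow> 0 \<le> p x"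
  using prob_vec by (auto simp: probability_vector_def)

lemma Q_nonneg: "Y \<in> atomic_sets n F \<Longrightarrow> 0 \<le> Q Y"
  using hitting by (auto simp: fractional_hitting_set_def)

lemma vpow_nonneg: "Y \<in> atomic_sets n F \<Longrightarrow> 0 \<le> vpow p Y"
  unfolding vpow_def by (intro prod_nonneg) (auto simp: atomic_sets_def intro: p_nonneg)

text \<open>
  The probability that \<open>Y\<close> holds when the variables in \<open>S\<close> are drawn anew and the others are as in \<open>X\<close>.
\<close>

definition agreement :: "nat set \<Rightarrow> 'v config \<Rightarrow> 'v elem set \<Rightarrow> ennreal" where
  "agreement S X Y = (\<Prod>x\<in>Y. if fst x \<in> S then ennreal (p x) else of_bool (X (fst x) = snd x))"

definition layer_likelihood :: "nat set \<Rightarrow> 'v config \<Rightarrow> ('v elem set \<times> 'v elem set) set \<Rightarrow> ennreal" where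
  "layer_likelihood S X I = (\<Prod>a\<in>I. ennreal (Q (fst a)) * agreement S X (fst a))"

definition vars :: "('v elem set \<times> 'v elem set) set list \<Rightarrow> nat set" where
  "vars t = (\<Union>Y\<in>labels t. fst ` Y)"

text \<open>
  In the level \<open>I\<close>, the variables that occur deeper have been redrawn since the start, as \<open>I\<close> is later in
  time; only the remaining ones still show the starting configuration \<open>X\<close>. The set \<open>S\<close> collects
  variables whose starting value is itself random.
\<close>

fun likelihood :: "nat set \<Rightarrow> 'v config \<Rightarrow> ('v elem set \<times> 'v elem set) set list \<Rightarrow> ennreal" where
  "likelihood S X [] = 1"
| "likelihood S X (I # L) = layer_likelihood (S \<union> vars L) X I * likelihood S X L"

lemma vars_simps [simp]: "vars [] = {}" "vars (I # L) = (\<Union>a\<in>I. fst ` fst a) \<union> vars L"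
  by (auto simp: vars_def)

lemma agreement_upd:
  "i \<in> S \<or> i \<notin> fst ` Y \<Longrightarrow> agreement S (X(i := x)) Y = agreement S X Y"
  unfolding agreement_def by (intro prod.cong) auto

lemma agreement_fresh:
  "fst ` Y \<inter> V = {} \<Longrightarrow> agreement (V \<union> S) X Y = agreement S X Y"
  unfolding agreement_def by (intro prod.cong) auto

lemma layer_likelihood_upd:
  "i \<in> S \<or> i \<notin> (\<Union>a\<in>I. fst ` fst a) \<Longrightarrow> layer_likelihood S (X(i := x)) I = layer_likelihood S X I"
  unfolding layer_likelihood_def by (intro prod.cong refl arg_cong2[where f = "(*)"] agreement_upd) auto

lemma layer_likelihood_fresh:
  "(\<Union>a\<in>I. fst ` fst a) \<inter> V = {} \<Longrightarrow> layer_likelihood (V \<union> S) X I = layer_likelihood S X I"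
  unfolding layer_likelihood_def
  by (intro prod.cong refl arg_cong2[where f = "(*)"] agreement_fresh) auto

lemma likelihood_upd:
  "i \<in> S \<or> i \<notin> vars t \<Longrightarrow> likelihood S (X(i := x)) t = likelihood S X t"
  by (induction t) (auto simp: layer_likelihood_upd)

lemma likelihood_fresh:
  "vars t \<inter> V = {} \<Longrightarrow> likelihood (V \<union> S) X t = likelihood S X t"
proof (induction t)
  case (Cons I L)
  have "(\<Union>a\<in>I. fst ` fst a) \<inter> V = {}" "vars L \<inter> V = {}"
    using Cons.prems by auto
  then show ?case
    using Cons.IH layer_likelihood_fresh[of I V "S \<union> vars L" X] by (simp add: Un_assoc)
qed simp

lemma agreement_resample:
  assumes "Y \<in> atomic_sets n F" "i \<in> fst ` Y" "i \<notin> S"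
  shows "(\<integral>\<^sup>+x. agreement S (X(i := x)) Y \<partial>measure_pmf (value_pmf F p i)) = agreement (insert i S) X Y"
proof -
  obtain j where j: "(i, j) \<in> Y"
    using assms(2) by auto
  define Z where "Z = Y - {(i, j)}"
  have Z: "Y = insert (i, j) Z" "(i, j) \<notin> Z" "finite Z"
    using j atomic_finite[OF assms(1)] by (auto simp: Z_def)
  have i: "i \<notin> fst ` Z"
  proof
    assume "i \<in> fst ` Z"
    then obtain x where "x \<in> Y" "fst x = i" "x \<noteq> (i, j)"
      by (auto simp: Z_def)
    then show False
      using assms(1) j inj_onD[of fst Y x "(i, j)"] by (auto simp: atomic_sets_def)
  qed
  have ij: "i \<in> {1..n}" "j \<in> F i"
    using assms(1) j by (auto simp: atomic_sets_def elements_def)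
  have "agreement S (X(i := x)) Y = indicator {j} x * agreement S X Z" for x
  proof -
    have "agreement S (X(i := x)) Y = of_bool (x = j) * agreement S (X(i := x)) Z"
      using Z assms(3) by (simp add: agreement_def)
    then show ?thesis
      using i by (simp add: agreement_upd indicator_def)
  qed
  moreover have "agreement (insert i S) X Y = ennreal (p (i, j)) * agreement S X Z"
    using Z agreement_fresh[of Z "{i}" S X] i by (simp add: agreement_def)
  moreover have "pmf (value_pmf F p i) j = p (i, j)"
    using pmf_value_pmf[OF finite_values prob_vec] ij by simp
  ultimately show ?thesis
    by (simp add: nn_integral_multc emeasure_pmf_single)
qed

lemma layer_likelihood_resample:
  assumes "layer I" "i \<notin> S" "i \<in> {1..n}"
  shows "(\<integral>\<^sup>+x. layer_likelihood S (X(i := x)) I \<partial>measure_pmf (value_pmf F p i))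
    = layer_likelihood (insert i S) X I"
proof (cases "i \<in> (\<Union>a\<in>I. fst ` fst a)")
  case False
  then show ?thesis
    using layer_likelihood_fresh[of I "{i}" S X]
    by (simp add: layer_likelihood_upd measure_pmf.emeasure_space_1)
next
  case True
  then obtain a where a: "a \<in> I" "i \<in> fst ` fst a" by blast
  define J where "J = I - {a}"
  have J: "I = insert a J" "a \<notin> J" "finite J"
    using a finite_layer[OF assms(1)] by (auto simp: J_def)
  have nJ: "i \<notin> (\<Union>b\<in>J. fst ` fst b)"
  proof
    assume "i \<in> (\<Union>b\<in>J. fst ` fst b)"
    then obtain b where "b \<in> J" "i \<in> fst ` fst b" by blast
    then have "rel_sim (fst a) (fst b)" "b \<in> I" "b \<noteq> a"
      using a by (auto simp: rel_sim_iff J_def)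
    then show False
      using assms(1) a by (auto simp: layer_def)
  qed
  have aA: "fst a \<in> atomic_sets n F"
    using a assms(1) by (auto simp: layer_def)
  have "layer_likelihood S (X(i := x)) I
      = agreement S (X(i := x)) (fst a) * (ennreal (Q (fst a)) * layer_likelihood S X J)" for x
  proof -
    have "layer_likelihood S (X(i := x)) I
        = ennreal (Q (fst a)) * agreement S (X(i := x)) (fst a) * layer_likelihood S (X(i := x)) J"
      using J by (simp add: layer_likelihood_def)
    then show ?thesis
      using nJ by (simp add: layer_likelihood_upd mult_ac)
  qed
  moreover have "layer_likelihood (insert i S) X I
      = agreement (insert i S) X (fst a) * (ennreal (Q (fst a)) * layer_likelihood S X J)"
  proof -
    have "layer_likelihood (insert i S) X I
        = ennreal (Q (fst a)) * agreement (insert i S) X (fst a) * layer_likelihood (insert i S) X J"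
      using J by (simp add: layer_likelihood_def)
    then show ?thesis
      using nJ layer_likelihood_fresh[of J "{i}" S X] by (simp add: mult_ac)
  qed
  ultimately show ?thesis
    using agreement_resample[OF aA a(2) assms(2)] by (simp add: nn_integral_multc)
qed

text \<open>
  Only the deepest occurrence of the variable \<open>i\<close> looks at its starting value, and on each level
  the variable occurs at most once; so averaging over the starting value replaces one
  indicator by one factor \<open>p\<close>.
\<close>

lemma likelihood_resample_one:
  assumes "tree t" "i \<in> {1..n}"
  shows "(\<integral>\<^sup>+x. likelihood S (X(i := x)) t \<partial>measure_pmf (value_pmf F p i)) = likelihood (insert i S) X t"
  using assms(1)
proof (induction t)
  case Nil
  then show ?case by (simp add: measure_pmf.emeasure_space_1)
next
  case (Cons I L)
  show ?case
  proof (cases "i \<in> S \<union> vars L")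
    case True
    then have "insert i S \<union> vars L = S \<union> vars L"
      by auto
    moreover have "likelihood S (X(i := x)) (I # L)
        = layer_likelihood (S \<union> vars L) X I * likelihood S (X(i := x)) L" for x
      using layer_likelihood_upd[OF disjI1[OF True]] by simp
    ultimately show ?thesis
      using Cons by (simp add: nn_integral_cmult del: fun_upd_apply)
  next
    case False
    then have "likelihood (insert i S) X L = likelihood S X L"
      using likelihood_fresh[of L "{i}" S X] by simp
    moreover have "(\<integral>\<^sup>+x. layer_likelihood (S \<union> vars L) (X(i := x)) I \<partial>measure_pmf (value_pmf F p i))
        = layer_likelihood (insert i S \<union> vars L) X I"
      using layer_likelihood_resample[of I i "S \<union> vars L" X] False Cons.prems assms(2) by simp
    moreover have "likelihood S (X(i := x)) (I # L)
        = layer_likelihood (S \<union> vars L) (X(i := x)) I * likelihood S X L" for x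
      using likelihood_upd[of i S L X x] False by simp
    ultimately show ?thesis
      by (simp add: nn_integral_multc del: fun_upd_apply)
  qed
qed

lemma likelihood_resample:
  assumes "tree t" "finite V" "V \<subseteq> {1..n}"
  shows "(\<integral>\<^sup>+X'. likelihood S (override_on X X' V) t \<partial>measure_pmf (Pi_pmf V undefined (value_pmf F p)))
    = likelihood (V \<union> S) X t"
  using assms(2,3)
proof (induction V arbitrary: X rule: finite_induct)
  case empty
  then show ?case by simp
next
  case (insert i V)
  have ov: "override_on X (f(i := x)) (insert i V) = override_on (X(i := x)) f V" for f x
    using insert.hyps by (auto simp: override_on_def fun_eq_iff)
  have "(\<integral>\<^sup>+X'. likelihood S (override_on X X' (insert i V)) t
      \<partial>measure_pmf (Pi_pmf (insert i V) undefined (value_pmf F p)))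
    = (\<integral>\<^sup>+x. likelihood (V \<union> S) (X(i := x)) t \<partial>measure_pmf (value_pmf F p i))"
    using insert by (simp add: Pi_pmf_insert' ov)
  also have "\<dots> = likelihood (insert i V \<union> S) X t"
    using likelihood_resample_one[OF assms(1)] insert.prems by simp
  finally show ?case .
qed

lemma likelihood_resample_pmf:
  assumes "tree t" "Y \<in> atomic_sets n F"
  shows "(\<integral>\<^sup>+X'. likelihood {} X' t \<partial>measure_pmf (resample_pmf F p Y X)) = likelihood (fst ` Y) X t"
  using likelihood_resample[OF assms(1), of "fst ` Y" "{}"] atomic_finite[OF assms(2)] atomic_vars[OF assms(2)]
  by (simp add: resample_pmf_def)

lemma likelihood_initial_pmf:
  assumes "tree t"
  shows "(\<integral>\<^sup>+X. likelihood {} X t \<partial>measure_pmf (initial_pmf n F p)) = likelihood {1..n} (\<lambda>_. undefined) t"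
proof -
  let ?u = "\<lambda>_::nat. undefined :: 'v"
  have ov: "override_on ?u X {1..n} = X" if "X \<in> set_pmf (initial_pmf n F p)" for X
    using that set_Pi_pmf_subset[of "{1..n}" undefined "value_pmf F p"]
    by (auto simp: initial_pmf_def override_on_def fun_eq_iff)
  have "(\<integral>\<^sup>+X. likelihood {} X t \<partial>measure_pmf (initial_pmf n F p))
      = (\<integral>\<^sup>+X. likelihood {} (override_on ?u X {1..n}) t \<partial>measure_pmf (initial_pmf n F p))"
    by (intro nn_integral_cong_AE) (simp add: AE_measure_pmf_iff ov del: One_nat_def)
  then show ?thesis
    using likelihood_resample[OF assms, of "{1..n}" "{}" ?u] by (simp add: initial_pmf_def)
qed

lemma likelihood_all:
  assumes "tree t"
  shows "likelihood {1..n} X t = weight (\<lambda>Y. ennreal (vpow p Y * Q Y)) t"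
  using assms
proof (induction t)
  case (Cons I L)
  have "ennreal (Q Y) * agreement ({1..n} \<union> V) X Y = ennreal (vpow p Y * Q Y)"
    if Y: "Y \<in> atomic_sets n F" for Y V
  proof -
    have "agreement ({1..n} \<union> V) X Y = (\<Prod>x\<in>Y. ennreal (p x))"
      unfolding agreement_def using atomic_vars[OF Y] by (intro prod.cong) auto
    also have "\<dots> = ennreal (vpow p Y)"
      unfolding vpow_def using Y p_nonneg by (intro prod_ennreal) (auto simp: atomic_sets_def)
    finally show ?thesis
      using vpow_nonneg[OF Y] Q_nonneg[OF Y] by (simp add: ennreal_mult mult.commute)
  qed
  then have "layer_likelihood ({1..n} \<union> vars L) X I = (\<Prod>a\<in>I. ennreal (vpow p (fst a) * Q (fst a)))"
    unfolding layer_likelihood_def using Cons.prems by (intro prod.cong) (auto simp: layer_def)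
  with Cons show ?case by simp
qed simp

lemma likelihood_unfold:
  "likelihood S X L = layer_likelihood (S \<union> vars (tl L)) X (top_layer L) * likelihood S X (tl L)"
  by (cases L) (auto simp: layer_likelihood_def)

text \<open>
  A newly hung node is the earliest one for all its variables: it is charged its agreement with \<open>X\<close>,
  while the rest of the tree sees these variables redrawn. This is the recursion that the first
  step of the algorithm satisfies.
\<close>

lemma likelihood_hang:
  assumes "hang Y s = Some t" "tree s" "Y \<in> atomic_sets n F"
  shows "likelihood {} X t = ennreal (Q Y) * agreement {} X Y * likelihood (fst ` Y) X s"
  using assms(1,2)
proof (induction s arbitrary: t)
  case (Cons I L)
  note [simp del] = likelihood.simps(2)
  have L: "tree L"
    using Cons.prems by simp
  from Cons.prems(1) show ?case
  proof (cases rule: hang_cases)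
    case (deep L')
    have "vars L' = fst ` Y \<union> vars L"
      using hang_tree(2)[OF deep(2) L assms(3)] by (auto simp: vars_def)
    then show ?thesis
      using deep Cons.IH[OF deep(2) L] by (simp add: likelihood.simps mult_ac)
  next
    case (here v)
    let ?J = "top_layer L" and ?R = "tl L"
    have disj: "fst ` Y \<inter> fst ` Z = {}" if "Z \<in> labels L" for Z
      using not_hung_not_sim[OF L here(2) assms(3) that] by (simp add: rel_sim_iff)
    have "vars ?R \<subseteq> vars L" "(\<Union>a\<in>?J. fst ` fst a) \<subseteq> vars L" "vars L \<inter> fst ` Y = {}"
      using disj unfolding vars_def labels_top_layer(2)[of L] by blast+
    then have dR: "vars ?R \<inter> fst ` Y = {}" and dJ: "(\<Union>a\<in>?J. fst ` fst a) \<inter> fst ` Y = {}"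
      by blast+
    have "(Y, v) \<notin> ?J"
      using disj[of Y] labels_top_layer(1)[of L] assms(3) by (force simp: atomic_sets_def)
    then have "layer_likelihood (vars ?R) X (insert (Y, v) ?J)
        = ennreal (Q Y) * agreement (vars ?R) X Y * layer_likelihood (vars ?R) X ?J"
      using finite_layer[OF top_layer_tree(1)[OF L]] by (simp add: layer_likelihood_def)
    also have "agreement (vars ?R) X Y = agreement {} X Y"
      using agreement_fresh[of Y "vars ?R" "{}" X] dR by (simp add: Int_commute)
    also have "layer_likelihood (vars ?R) X ?J = layer_likelihood (fst ` Y \<union> vars ?R) X ?J"
      using layer_likelihood_fresh[OF dJ] by simp
    finally have J: "layer_likelihood (vars ?R) X (insert (Y, v) ?J)
        = ennreal (Q Y) * agreement {} X Y * layer_likelihood (fst ` Y \<union> vars ?R) X ?J" .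
    have R: "likelihood {} X ?R = likelihood (fst ` Y) X ?R"
      using likelihood_fresh[OF dR, of "{}" X] by simp
    have "vars (insert (Y, v) ?J # ?R) = fst ` Y \<union> vars L"
      using labels_top_layer(2)[of L] by (auto simp: vars_def)
    then show ?thesis
      using here(1) J R likelihood_unfold[of "fst ` Y" X L]
      by (simp add: likelihood.simps mult_ac del: vars_simps)
  qed
qed simp

lemma likelihood_grows:
  assumes "grows Y s t" "tree s" "Y \<in> atomic_sets n F"
  shows "likelihood {} X t = ennreal (Q Y) * agreement {} X Y * likelihood (fst ` Y) X s"
  using assms likelihood_hang[of Y s t X] by (auto simp: grows_def layer_likelihood_def)

end

section \<open>Counting resamplings by witness trees\<close>

context neighborhood
begin

text \<open>
  The witness trees of all resamplings of a run (listed in order of time), computed from the end of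
  the run. The additional empty tree is the one whose root is the next resampling before the list.
\<close>

fun witnesses :: "'a list \<Rightarrow> ('a \<times> 'a) set list list" where
  "witnesses [] = [[]]"
| "witnesses (Y # Ys) = [] # map (extend Y) (witnesses Ys)"

lemma length_witnesses: "length (witnesses Ys) = Suc (length Ys)"
  by (induction Ys) auto

lemma count_map_eq_count:
  assumes "\<And>s. s \<in> set ss \<Longrightarrow> f s = t \<longleftrightarrow> s = u"
  shows "count_list (map f ss) t = count_list ss u"
  using assms by (induction ss) auto

lemma extend_not_Nil: "extend Y s \<noteq> []"
  using hang_Some_shape(2)[of Y s] by (auto simp: extend_def split: option.splits)

lemma count_witnesses_Nil: "count_list (witnesses Ys) [] = 1"
proof -
  have "count_list (map (extend Y) ss) [] = 0" for Y ss
    by (induction ss) (auto simp: extend_not_Nil)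
  then show ?thesis
    by (cases Ys) auto
qed

lemma tree_extend: "tree s \<Longrightarrow> Y \<in> A \<Longrightarrow> tree (extend Y s)"
  using extend_eq_iff[of Y s "extend Y s"] grows_tree(1) by auto

lemma tree_witnesses: "set Ys \<subseteq> A \<Longrightarrow> s \<in> set (witnesses Ys) \<Longrightarrow> tree s"
  by (induction Ys arbitrary: s) (auto simp: tree_extend)

text \<open>
  Since \<open>Y\<close> is \<open>sim\<close> to itself, it is never left out of a tree that contains it; so the trees that
  become \<open>t\<close> do so by gaining \<open>Y\<close>, and there is only one such tree.
\<close>

lemma count_witnesses_grows:
  assumes "set Ys \<subseteq> A" "Y \<in> A" "grows Y s t" "tree s"
  shows "count_list (witnesses (Y # Ys)) t = count_list (witnesses Ys) s"
proof -
  have t: "t \<noteq> []" "hang Y t \<noteq> None"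
    using assms sim_refl grows_then_related_hangs[of Y s t Y] hang_Some_shape(2)[of Y s t]
    by (auto simp: grows_def)
  have "extend Y u = t \<longleftrightarrow> u = s" if "u \<in> set (witnesses Ys)" for u
    using assms t grows_unique(2)[of Y s t Y u] tree_witnesses[OF assms(1) that] sim_refl
    by (auto simp: extend_eq_iff)
  then show ?thesis
    using t(1) by (auto simp: count_map_eq_count)
qed

lemma
  assumes "set Ys \<subseteq> A" "t \<noteq> []" "\<And>s. tree s \<Longrightarrow> \<not> grows Y s t"
  shows count_witnesses_unrelated:
      "hang Y t = None \<Longrightarrow> count_list (witnesses (Y # Ys)) t = count_list (witnesses Ys) t"
    and count_witnesses_impossible:
      "hang Y t \<noteq> None \<Longrightarrow> count_list (witnesses (Y # Ys)) t = 0"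
proof -
  have ext: "extend Y u = t \<longleftrightarrow> u = t \<and> hang Y t = None" if "u \<in> set (witnesses Ys)" for u
    using assms(2,3) tree_witnesses[OF assms(1) that] by (auto simp: extend_eq_iff)
  show "count_list (witnesses (Y # Ys)) t = count_list (witnesses Ys) t" if "hang Y t = None"
    using ext that assms(2) by (auto simp: count_map_eq_count)
  assume "hang Y t \<noteq> None"
  then have "extend Y u \<noteq> t" if "u \<in> set (witnesses Ys)" for u
    using ext[OF that] by simp
  then have "t \<notin> set (map (extend Y) (witnesses Ys))"
    by auto
  then show "count_list (witnesses (Y # Ys)) t = 0"
    using assms(2) by (auto simp: count_list_0_iff)
qed

lemma rooted_extend:
  assumes "s \<noteq> [] \<longrightarrow> (\<exists>Z\<in>A. hd s = {(Z, Z)})" "Y \<in> A"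
  shows "\<exists>Z\<in>A. hd (extend Y s) = {(Z, Z)}"
proof (cases "s = []")
  case False
  then have "hd (extend Y s) = hd s"
    using hang_Some_shape(4)[of Y s] by (simp add: extend_def split: option.split)
  with False assms(1) show ?thesis by simp
qed (use assms(2) in \<open>auto simp: extend_def\<close>)

lemma length_hang: "hang Y s = Some t \<Longrightarrow> length t \<le> Suc (length s)"
proof (induction s arbitrary: t)
  case (Cons I L)
  from Cons.prems show ?case
    by (cases rule: hang_cases) (use Cons.IH in auto)
qed simp

lemma length_extend: "length (extend Y s) \<le> Suc (length s)"
  using length_hang[of Y s] by (auto simp: extend_def split: option.splits)

lemma witnesses_rooted:
  assumes "set Ys \<subseteq> A" "s \<in> set (witnesses Ys)" "s \<noteq> []"
  shows "\<exists>Z\<in>A. s \<in> trees_from (length Ys) {(Z, Z)}"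
proof -
  have "(s \<noteq> [] \<longrightarrow> (\<exists>Z\<in>A. hd s = {(Z, Z)})) \<and> length s \<le> length Ys"
    using assms(1,2)
  proof (induction Ys arbitrary: s)
    case (Cons Y Ys)
    show ?case
    proof (cases "s = []")
      case False
      then obtain u where u: "u \<in> set (witnesses Ys)" "s = extend Y u"
        using Cons.prems by auto
      then have "(u \<noteq> [] \<longrightarrow> (\<exists>Z\<in>A. hd u = {(Z, Z)})) \<and> length u \<le> length Ys"
        using Cons by simp
      then show ?thesis
        using u(2) rooted_extend[of u Y] length_extend[of Y u] Cons.prems by auto
    qed simp
  qed simp
  then show ?thesis
    using assms(3) tree_witnesses[OF assms(1,2)] by (auto simp: trees_from_def)
qed

text \<open>
  Every resampling contributes exactly one non-empty witness tree, of depth at most \<open>m\<close>; the bound on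
  the depth leaves a finite set of trees to sum over.
\<close>

lemma length_eq_sum_count:
  assumes "set Ys \<subseteq> A" "length Ys \<le> m"
  shows "length Ys = (\<Sum>t\<in>(\<Union>Y\<in>A. trees_from m {(Y, Y)}). count_list (witnesses Ys) t)"
proof -
  let ?T = "\<Union>Y\<in>A. trees_from m {(Y, Y)}"
  have fin: "finite ?T"
    using finite_A finite_trees_from by auto
  have nil: "[] \<notin> ?T"
    by (auto simp: trees_from_def)
  have sub: "set (witnesses Ys) \<subseteq> insert [] ?T"
  proof
    fix s assume s: "s \<in> set (witnesses Ys)"
    show "s \<in> insert [] ?T"
    proof (cases "s = []")
      case False
      then show ?thesis
        using witnesses_rooted[OF assms(1) s] assms(2) by (auto simp: trees_from_def)
    qed simp
  qed
  have "Suc (length Ys) = (\<Sum>t\<in>set (witnesses Ys). count_list (witnesses Ys) t)"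
    by (simp add: sum_count_set length_witnesses)
  also have "\<dots> = (\<Sum>t\<in>insert [] ?T. count_list (witnesses Ys) t)"
    using sub fin by (intro sum.mono_neutral_left) (auto simp: count_list_0_iff)
  also have "\<dots> = 1 + (\<Sum>t\<in>?T. count_list (witnesses Ys) t)"
    using fin nil by (simp add: count_witnesses_Nil)
  finally show ?thesis by simp
qed

end

context pra_setting
begin

text \<open>
  The sequence of resampled sets, in order of time, during the first \<open>m\<close> iterations of the loop.
\<close>

primrec run :: "nat \<Rightarrow> 'v config \<Rightarrow> 'v history \<Rightarrow> 'v elem set list pmf" where
  "run 0 X h = return_pmf []"
| "run (Suc m) X h =
     (if \<exists>B\<in>\<B>. holds B X then
        bind_pmf (sel X h) (\<lambda>B.
        bind_pmf (subset_pmf Q B) (\<lambda>Y.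
        bind_pmf (resample_pmf F p Y X) (\<lambda>X'.
          map_pmf ((#) Y) (run m X' ((X, B, Y) # h)))))
      else return_pmf [])"

lemma selected_bad:
  assumes "\<exists>B\<in>\<B>. holds B X" "B \<in> set_pmf (sel X h)"
  shows "B \<in> \<B>" "holds B X"
  using valid_sel assms unfolding valid_selector_def by blast+

lemma subset_of_bad_atomic:
  assumes "B \<in> \<B>" "Y \<in> nonempty_subsets B"
  shows "Y \<in> atomic_sets n F"
  using assms bad_atomic by (auto simp: nonempty_subsets_def atomic_sets_def intro: inj_on_subset)

lemma drawn_subset:
  assumes "B \<in> \<B>" "Y \<in> set_pmf (subset_pmf Q B)"
  shows "Y \<in> nonempty_subsets B" "Y \<in> atomic_sets n F"
proof -
  show "Y \<in> nonempty_subsets B"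
    using assms(2) pmf_subset_pmf[OF finite_values bad_atomic hitting assms(1), of Y]
    by (auto simp: set_pmf_iff split: if_splits)
  then show "Y \<in> atomic_sets n F"
    using subset_of_bad_atomic assms(1) by blast
qed

lemma pmf_subset_le:
  assumes "B \<in> \<B>" "Y \<in> nonempty_subsets B"
  shows "pmf (subset_pmf Q B) Y \<le> Q Y"
proof -
  have "1 \<le> (\<Sum>Z\<in>nonempty_subsets B. Q Z)"
    using hitting assms(1) by (auto simp: fractional_hitting_set_def)
  moreover have "0 \<le> Q Y"
    using Q_nonneg subset_of_bad_atomic[OF assms] by blast
  ultimately show ?thesis
    using pmf_subset_pmf[OF finite_values bad_atomic hitting assms(1), of Y] assms(2)
    by (simp add: divide_le_eq mult_left_le mult_le_cancel_left1)
qed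

lemma run_atomic:
  assumes "Ys \<in> set_pmf (run m X h)"
  shows "set Ys \<subseteq> atomic_sets n F" "length Ys \<le> m"
proof -
  have "set Ys \<subseteq> atomic_sets n F \<and> length Ys \<le> m"
    using assms
  proof (induction m arbitrary: X h Ys)
    case (Suc m)
    show ?case
    proof (cases "\<exists>B\<in>\<B>. holds B X")
      case True
      with Suc.prems obtain B Y X' Zs where *: "B \<in> set_pmf (sel X h)" "Y \<in> set_pmf (subset_pmf Q B)"
        "Zs \<in> set_pmf (run m X' ((X, B, Y) # h))" "Ys = Y # Zs"
        by auto
      then show ?thesis
        using Suc.IH[OF *(3)] drawn_subset(2) selected_bad(1)[OF True *(1)] by auto
    qed (use Suc.prems in auto)
  qed simp
  then show "set Ys \<subseteq> atomic_sets n F" "length Ys \<le> m" by auto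
qed

lemma subsets_of_bad_related:
  assumes "B \<in> \<B>" "Y \<subseteq> B" "Z \<subseteq> B"
  shows "rel_sim Z Y \<or> rel_bowtie \<B> Z Y"
  using assms by (auto simp: rel_bowtie_def)

lemma agreement_holds:
  assumes "holds B X" "Y \<subseteq> B"
  shows "agreement {} X Y = 1"
  using assms unfolding agreement_def by (intro prod.neutral) (fastforce simp: holds_def)

text \<open>
  The two cases for a selected \<open>B\<close> are those of the introduction: either exactly one subset \<open>Y\<close> of \<open>B\<close>
  can lead to \<open>t\<close>, and drawing it costs \<open>Q(Y)\<close>, or the subsets that lead to \<open>t\<close> leave \<open>t\<close> untouched.
  The trees are kept arbitrary in the induction because the first step removes a leaf.
\<close>

lemma expected_count_le_likelihood:
  assumes "tree t"
  shows "(\<integral>\<^sup>+Ys. of_nat (count_list (witnesses Ys) t) \<partial>measure_pmf (run m X h)) \<le> likelihood {} X t"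
  using assms
proof (induction m arbitrary: X h t)
  case 0
  then show ?case
    by (cases t) auto
next
  case (Suc m)
  show ?case
  proof (cases "t = []")
    case True
    then show ?thesis
      by (simp only: count_witnesses_Nil) (simp add: measure_pmf.emeasure_space_1)
  next
    case t: False
    show ?thesis
    proof (cases "\<exists>B\<in>\<B>. holds B X")
      case False
      then show ?thesis
        using t by simp
    next
      case True
      define g where "g B Y = (\<integral>\<^sup>+X'. \<integral>\<^sup>+Ys. of_nat (count_list (witnesses (Y # Ys)) t)
        \<partial>measure_pmf (run m X' ((X, B, Y) # h)) \<partial>measure_pmf (resample_pmf F p Y X))"
        for B Y :: "'v elem set"
      have g_cong: "g B Y = (\<integral>\<^sup>+X'. \<integral>\<^sup>+Ys. of_nat (f Ys)
        \<partial>measure_pmf (run m X' ((X, B, Y) # h)) \<partial>measure_pmf (resample_pmf F p Y X))"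
        if "\<And>Ys. set Ys \<subseteq> atomic_sets n F \<Longrightarrow> count_list (witnesses (Y # Ys)) t = f Ys" for B Y f
        unfolding g_def
        by (intro nn_integral_cong nn_integral_cong_AE) (auto simp: AE_measure_pmf_iff that[OF run_atomic(1)] simp del: witnesses.simps)
      have g_le: "g B Y \<le> likelihood (fst ` Y) X s"
        if Y: "Y \<in> atomic_sets n F" and s: "tree s"
          and eq: "\<And>Ys. set Ys \<subseteq> atomic_sets n F \<Longrightarrow>
            count_list (witnesses (Y # Ys)) t = count_list (witnesses Ys) s" for B Y s
      proof -
        have "g B Y = (\<integral>\<^sup>+X'. \<integral>\<^sup>+Ys. of_nat (count_list (witnesses Ys) s)
            \<partial>measure_pmf (run m X' ((X, B, Y) # h)) \<partial>measure_pmf (resample_pmf F p Y X))"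
          by (rule g_cong[OF eq])
        also have "\<dots> \<le> (\<integral>\<^sup>+X'. likelihood {} X' s \<partial>measure_pmf (resample_pmf F p Y X))"
          by (intro nn_integral_mono Suc.IH s)
        finally show ?thesis
          by (simp add: likelihood_resample_pmf[OF s Y])
      qed
      have "(\<integral>\<^sup>+Y. g B Y \<partial>measure_pmf (subset_pmf Q B)) \<le> likelihood {} X t"
        if B: "B \<in> set_pmf (sel X h)" for B
      proof -
        note bad = selected_bad[OF True B]
        show ?thesis
        proof (cases "\<exists>Y\<in>nonempty_subsets B. \<exists>s. tree s \<and> grows Y s t")
          case True
          then obtain Y s where Y: "Y \<in> nonempty_subsets B" "tree s" "grows Y s t" by blast
          have YA: "Y \<in> atomic_sets n F"
            using subset_of_bad_atomic[OF bad(1) Y(1)] .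
          \<comment> \<open>Any other subset of \<open>B\<close> is related to \<open>Y\<close>, so it would be hung on \<open>t\<close>, yet it cannot be the last node of \<open>t\<close>.\<close>
          have zero: "g B Z = 0" if Z: "Z \<in> set_pmf (subset_pmf Q B)" "Z \<noteq> Y" for Z
          proof -
            note ZA = drawn_subset[OF bad(1) Z(1)]
            have rel: "rel_sim Z Y \<or> rel_bowtie \<B> Z Y"
              using subsets_of_bad_related[OF bad(1)] Y(1) ZA(1) by (auto simp: nonempty_subsets_def)
            then have "\<not> grows Z s' t" if "tree s'" for s'
              using grows_unique(1)[OF Y(3) _ Y(2) that YA ZA(2)] Z(2) by blast
            moreover have "hang Z t \<noteq> None"
              using grows_then_related_hangs[OF Y(3,2) YA rel] .
            ultimately have "count_list (witnesses (Z # Ys)) t = 0"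
              if "set Ys \<subseteq> atomic_sets n F" for Ys
              using count_witnesses_impossible[OF that t] by blast
            then show ?thesis
              using g_cong[of Z "\<lambda>_. 0"] by simp
          qed
          have "(\<integral>\<^sup>+Z. g B Z \<partial>measure_pmf (subset_pmf Q B))
              = (\<integral>\<^sup>+Z. g B Y * indicator {Y} Z \<partial>measure_pmf (subset_pmf Q B))"
            using zero by (intro nn_integral_cong_AE) (auto simp: AE_measure_pmf_iff indicator_def)
          also have "\<dots> = g B Y * ennreal (pmf (subset_pmf Q B) Y)"
            by (simp add: nn_integral_cmult emeasure_pmf_single)
          also have "\<dots> \<le> likelihood (fst ` Y) X s * ennreal (Q Y)"
            using pmf_subset_le[OF bad(1) Y(1)]
            by (intro mult_mono g_le YA Y count_witnesses_grows ennreal_leI) auto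
          also have "\<dots> = likelihood {} X t"
            using likelihood_grows[OF Y(3,2) YA, of X] agreement_holds[OF bad(2), of Y] Y(1)
            by (simp add: nonempty_subsets_def mult.commute)
          finally show ?thesis .
        next
          case False
          show ?thesis
          proof (rule nn_integral_pmf_le_const)
            fix Y assume Y: "Y \<in> set_pmf (subset_pmf Q B)"
            note YA = drawn_subset[OF bad(1) Y]
            have ng: "\<not> grows Y s t" if "tree s" for s
              using False YA(1) that by blast
            show "g B Y \<le> likelihood {} X t"
            proof (cases "hang Y t = None")
              case True
              have "vars t \<inter> fst ` Y = {}"
                using not_hung_not_sim[OF Suc.prems True YA(2)] by (auto simp: vars_def rel_sim_iff)
              then have "likelihood (fst ` Y) X t = likelihood {} X t"
                using likelihood_fresh[of t "fst ` Y" "{}" X] by simp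
              moreover have "g B Y \<le> likelihood (fst ` Y) X t"
                using True by (intro g_le YA Suc.prems count_witnesses_unrelated[OF _ t ng])
              ultimately show ?thesis by simp
            next
              case False
              then have "g B Y = 0"
                using g_cong[of Y "\<lambda>_. 0"] count_witnesses_impossible[OF _ t ng] by simp
              then show ?thesis by simp
            qed
          qed
        qed
      qed
      then have "(\<integral>\<^sup>+B. \<integral>\<^sup>+Y. g B Y \<partial>measure_pmf (subset_pmf Q B) \<partial>measure_pmf (sel X h)) \<le> likelihood {} X t"
        by (rule nn_integral_pmf_le_const)
      then show ?thesis
        using True by (simp add: g_def del: witnesses.simps)
    qed
  qed
qed

lemma expected_run_length_le:
  assumes mu: "\<And>Y. Y \<in> atomic_sets n F \<Longrightarrow>
      ennreal (vpow p Y * Q Y) * (\<Sum>T\<in>nbr_sets Y. \<Prod>Z\<in>T. M Z) \<le> M Y"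
  shows "(\<integral>\<^sup>+X. \<integral>\<^sup>+Ys. of_nat (length Ys) \<partial>measure_pmf (run m X []) \<partial>measure_pmf (initial_pmf n F p))
    \<le> (\<Sum>Y\<in>atomic_sets n F. M Y)"
proof -
  let ?A = "atomic_sets n F" and ?w = "\<lambda>Y. ennreal (vpow p Y * Q Y)"
  let ?T = "\<Union>Y\<in>?A. trees_from m {(Y, Y)}"
  have len: "(\<integral>\<^sup>+Ys. of_nat (length Ys) \<partial>measure_pmf (run m X [])) \<le> (\<Sum>t\<in>?T. likelihood {} X t)" for X
  proof -
    have "(\<integral>\<^sup>+Ys. of_nat (length Ys) \<partial>measure_pmf (run m X []))
        = (\<integral>\<^sup>+Ys. (\<Sum>t\<in>?T. of_nat (count_list (witnesses Ys) t)) \<partial>measure_pmf (run m X []))"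
      by (intro nn_integral_cong_AE)
         (simp add: AE_measure_pmf_iff length_eq_sum_count[OF run_atomic] flip: of_nat_sum)
    also have "\<dots> = (\<Sum>t\<in>?T. \<integral>\<^sup>+Ys. of_nat (count_list (witnesses Ys) t) \<partial>measure_pmf (run m X []))"
      by (rule nn_integral_sum) simp
    also have "\<dots> \<le> (\<Sum>t\<in>?T. likelihood {} X t)"
      by (intro sum_mono expected_count_le_likelihood) (auto simp: trees_from_def)
    finally show ?thesis .
  qed
  have "(\<integral>\<^sup>+X. \<integral>\<^sup>+Ys. of_nat (length Ys) \<partial>measure_pmf (run m X []) \<partial>measure_pmf (initial_pmf n F p))
      \<le> (\<integral>\<^sup>+X. (\<Sum>t\<in>?T. likelihood {} X t) \<partial>measure_pmf (initial_pmf n F p))"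
    by (intro nn_integral_mono len)
  also have "\<dots> = (\<Sum>t\<in>?T. \<integral>\<^sup>+X. likelihood {} X t \<partial>measure_pmf (initial_pmf n F p))"
    by (rule nn_integral_sum) simp
  also have "\<dots> = (\<Sum>t\<in>?T. weight ?w t)"
    by (intro sum.cong) (auto simp: trees_from_def likelihood_initial_pmf likelihood_all simp del: One_nat_def)
  also have "\<dots> = (\<Sum>Y\<in>?A. \<Sum>t\<in>trees_from m {(Y, Y)}. weight ?w t)"
    using finite_A finite_trees_from by (intro sum.UNION_disjoint) (auto simp: trees_from_def)
  also have "\<dots> \<le> (\<Sum>Y\<in>?A. M Y)"
  proof (rule sum_mono)
    fix Y assume "Y \<in> ?A"
    then show "(\<Sum>t\<in>trees_from m {(Y, Y)}. weight ?w t) \<le> M Y"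
      using sum_weight_trees_from_le[of ?w M "{(Y, Y)}" m] mu by (simp add: layer_def)
  qed
  finally show ?thesis .
qed

end

section \<open>From truncated runs to the loop\<close>

context pra_setting
begin

text \<open>
  Runs that do not stop, and those that would stop in a configuration with a true bad-event, are
  charged infinitely much. A finite expectation of this cost therefore yields termination,
  correctness and the bound on the number of resamplings at once.
\<close>

definition cost :: "('v config \<times> 'v history) option \<Rightarrow> ennreal" where
  "cost r = (case r of None \<Rightarrow> \<infinity>
     | Some (X, h) \<Rightarrow> if \<exists>B\<in>\<B>. holds B X then \<infinity> else of_nat (length h))"

lemma min_diff_Suc_le:
  fixes c :: ennreal
  shows "min (of_nat (Suc m)) (c - of_nat k) \<le> 1 + min (of_nat m) (c - of_nat (Suc k))"
proof -
  have "c - of_nat k \<le> 1 + (c - of_nat (Suc k))"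
  proof (cases c)
    case (real r)
    have "c - of_nat k = ennreal (r - real k)" "c - of_nat (Suc k) = ennreal (r - real (Suc k))"
      unfolding real(2) ennreal_of_nat_eq_real_of_nat by (simp_all only: ennreal_minus of_nat_0_le_iff)
    moreover have "ennreal (r - real k) \<le> ennreal (1 + max 0 (r - real (Suc k)))"
      by (intro ennreal_leI) auto
    ultimately show ?thesis
      by (simp add: max_def ennreal_neg split: if_splits)
  qed (simp add: ennreal_top_minus)
  then have "min (of_nat (Suc m)) (c - of_nat k) \<le> min (1 + of_nat m) (1 + (c - of_nat (Suc k)))"
    by (intro min.mono) simp_all
  also have "\<dots> = 1 + min (of_nat m) (c - of_nat (Suc k))"
    by (rule min_of_mono[where f = "(+) 1"]) (auto intro: monoI add_left_mono)
  finally show ?thesis .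
qed

text \<open>
  One unfolding of the loop equation consumes one truncation level, hence the induction on \<open>m\<close>.
  The cost also counts the resamplings already recorded in \<open>h\<close>, so these are subtracted.
\<close>

lemma expected_truncated_cost_le:
  "(\<integral>\<^sup>+r. min (of_nat m) (cost r - of_nat (length h)) \<partial>measure_pmf (pra_loop F p Q \<B> sel X h))
    \<le> (\<integral>\<^sup>+Ys. of_nat (length Ys) \<partial>measure_pmf (run m X h))"
proof (induction m arbitrary: X h)
  case 0
  then show ?case by simp
next
  case (Suc m)
  show ?case
  proof (cases "\<exists>B\<in>\<B>. holds B X")
    case False
    then show ?thesis
      by (subst pra_loop.simps) (simp add: cost_def)
  next
    case True
    have "(\<integral>\<^sup>+r. min (of_nat (Suc m)) (cost r - of_nat (length h))
          \<partial>measure_pmf (pra_loop F p Q \<B> sel X' ((X, B, Y) # h)))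
        \<le> (\<integral>\<^sup>+Ys. of_nat (length (Y # Ys)) \<partial>measure_pmf (run m X' ((X, B, Y) # h)))" (is "?l \<le> ?r")
      for B Y X'
    proof -
      let ?M = "measure_pmf (pra_loop F p Q \<B> sel X' ((X, B, Y) # h))"
      have "?l \<le> (\<integral>\<^sup>+r. 1 + min (of_nat m) (cost r - of_nat (length ((X, B, Y) # h))) \<partial>?M)"
        by (intro nn_integral_mono) (use min_diff_Suc_le in simp)
      also have "\<dots> = 1 + (\<integral>\<^sup>+r. min (of_nat m) (cost r - of_nat (length ((X, B, Y) # h))) \<partial>?M)"
        by (subst nn_integral_add) (simp_all add: measure_pmf.emeasure_space_1)
      also have "\<dots> \<le> 1 + (\<integral>\<^sup>+Ys. of_nat (length Ys) \<partial>measure_pmf (run m X' ((X, B, Y) # h)))"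
        by (intro add_left_mono Suc.IH)
      also have "\<dots> = ?r"
        by (simp add: nn_integral_add measure_pmf.emeasure_space_1)
      finally show ?thesis .
    qed
    then show ?thesis
      using True by (subst pra_loop.simps) (simp add: nn_integral_mono del: of_nat_Suc list.size)
  qed
qed

lemma expected_cost_le:
  assumes "\<And>m. (\<integral>\<^sup>+X. \<integral>\<^sup>+Ys. of_nat (length Ys) \<partial>measure_pmf (run m X []) \<partial>measure_pmf (initial_pmf n F p)) \<le> C"
  shows "(\<integral>\<^sup>+r. cost r \<partial>measure_pmf (pra n F p Q \<B> sel)) \<le> C"
proof -
  let ?M = "measure_pmf (pra n F p Q \<B> sel)"
  have sup: "(SUP m. min (of_nat m) c) = c" for c :: ennreal
    by (metis SUP_inf ennreal_SUP_of_nat_eq_top inf_min inf_top.left_neutral)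
  have "(\<integral>\<^sup>+r. cost r \<partial>?M) = (\<integral>\<^sup>+r. (SUP m. min (of_nat m) (cost r)) \<partial>?M)"
    by (simp add: sup)
  also have "\<dots> = (SUP m. \<integral>\<^sup>+r. min (of_nat m) (cost r) \<partial>?M)"
    by (intro nn_integral_monotone_convergence_SUP)
       (auto simp: incseq_def le_fun_def intro: min.coboundedI1 min.mono)
  also have "\<dots> \<le> C"
  proof (rule SUP_least)
    fix m
    have "(\<integral>\<^sup>+r. min (of_nat m) (cost r) \<partial>?M)
        = (\<integral>\<^sup>+X. \<integral>\<^sup>+r. min (of_nat m) (cost r) \<partial>measure_pmf (pra_loop F p Q \<B> sel X []) \<partial>measure_pmf (initial_pmf n F p))"
      by (simp add: pra_def)
    also have "\<dots> \<le> (\<integral>\<^sup>+X. \<integral>\<^sup>+Ys. of_nat (length Ys) \<partial>measure_pmf (run m X []) \<partial>measure_pmf (initial_pmf n F p))"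
      by (intro nn_integral_mono) (use expected_truncated_cost_le[where m = m and h = "[]"] in simp)
    also have "\<dots> \<le> C" by fact
    finally show "(\<integral>\<^sup>+r. min (of_nat m) (cost r) \<partial>?M) \<le> C" .
  qed
  finally show ?thesis .
qed

lemma pra_correct_of_cost:
  assumes "(\<integral>\<^sup>+r. cost r \<partial>measure_pmf (pra n F p Q \<B> sel)) \<le> ennreal c"
  shows "as_terminates_avoiding \<B> (pra n F p Q \<B> sel) \<and>
    expected_resamplings (pra n F p Q \<B> sel) \<le> ennreal c"
proof
  have "(\<integral>\<^sup>+r. cost r \<partial>measure_pmf (pra n F p Q \<B> sel)) \<noteq> \<infinity>"
    using assms by (auto simp: top_unique)
  then have "AE r in measure_pmf (pra n F p Q \<B> sel). cost r \<noteq> \<infinity>"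
    by (intro nn_integral_PInf_AE) auto
  then show "as_terminates_avoiding \<B> (pra n F p Q \<B> sel)"
    unfolding as_terminates_avoiding_def
    by (rule AE_mp) (auto simp: cost_def split: option.splits if_splits intro!: AE_I2)
  have "num_resamplings r \<le> cost r" for r :: "('v config \<times> 'v history) option"
    by (auto simp: num_resamplings_def cost_def split: option.splits)
  then have "expected_resamplings (pra n F p Q \<B> sel) \<le> (\<integral>\<^sup>+r. cost r \<partial>measure_pmf (pra n F p Q \<B> sel))"
    unfolding expected_resamplings_def by (intro nn_integral_mono)
  then show "expected_resamplings (pra n F p Q \<B> sel) \<le> ennreal c"
    using assms by (rule order_trans)
qed

end

section \<open>Convergence criteria\<close>

lemma sum_prod_Pow:
  fixes f :: "'a \<Rightarrow> 'b :: comm_semiring_1"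
  assumes "finite S"
  shows "(\<Sum>T\<in>Pow S. \<Prod>Z\<in>T. f Z) = (\<Prod>Z\<in>S. 1 + f Z)"
  using prod_add[OF assms, of f "\<lambda>_. 1"] by (simp add: add.commute)

context neighborhood
begin

text \<open>
  A neighbor-set splits into a set of labels \<open>sim\<close> to \<open>Y\<close> and at most one label in relation \<open>bow\<close> to \<open>Y\<close>,
  and the two parts determine it.
\<close>

lemma sum_nbr_sets_le_split:
  fixes \<mu> :: "'a \<Rightarrow> real"
  assumes nonneg: "\<And>Z. Z \<in> A \<Longrightarrow> 0 \<le> \<mu> Z"
  shows "(\<Sum>T\<in>nbr_sets Y. \<Prod>Z\<in>T. \<mu> Z)
    \<le> (\<Prod>Z\<in>{Z\<in>A. sim Z Y}. 1 + \<mu> Z) * (1 + (\<Sum>Z\<in>{Z\<in>A. bow Z Y}. \<mu> Z))"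
proof -
  let ?S = "{Z\<in>A. sim Z Y}" and ?W = "{Z\<in>A. bow Z Y}"
  let ?V = "insert {} ((\<lambda>Z. {Z}) ` ?W)"
  let ?f = "\<lambda>T. (T \<inter> ?S, T \<inter> ?W)" and ?g = "\<lambda>(U, V). (\<Prod>Z\<in>U. \<mu> Z) * (\<Prod>Z\<in>V. \<mu> Z)"
  have fin: "finite ?S" "finite ?W"
    using finite_A by auto
  have part: "T = (T \<inter> ?S) \<union> (T \<inter> ?W)" "(T \<inter> ?S) \<inter> (T \<inter> ?W) = {}" if "T \<in> nbr_sets Y" for T
    using that bow_not_sim by (auto simp: nbr_sets_def)
  have inj: "inj_on ?f (nbr_sets Y)"
    using part(1) by (intro inj_onI) (metis (no_types, lifting) Pair_inject)
  have range: "?f ` nbr_sets Y \<subseteq> Pow ?S \<times> ?V"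
  proof -
    have "T \<inter> ?W \<in> ?V" if "T \<in> nbr_sets Y" for T
    proof (cases "T \<inter> ?W = {}")
      case False
      then obtain Z where Z: "Z \<in> T" "Z \<in> ?W" by blast
      then have "T \<inter> ?W = {Z}"
        using that by (auto simp: nbr_sets_def)
      with Z(2) show ?thesis by blast
    qed simp
    then show ?thesis by auto
  qed
  have "(\<Sum>T\<in>nbr_sets Y. \<Prod>Z\<in>T. \<mu> Z) = (\<Sum>T\<in>nbr_sets Y. ?g (?f T))"
  proof (rule sum.cong)
    fix T assume T: "T \<in> nbr_sets Y"
    have "(\<Prod>Z\<in>T. \<mu> Z) = (\<Prod>Z\<in>(T \<inter> ?S) \<union> (T \<inter> ?W). \<mu> Z)"
      using part(1)[OF T] by simp
    also have "\<dots> = ?g (?f T)"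
      using fin part(2)[OF T] by (subst prod.union_disjoint) auto
    finally show "(\<Prod>Z\<in>T. \<mu> Z) = ?g (?f T)" .
  qed simp
  also have "\<dots> = (\<Sum>x\<in>?f ` nbr_sets Y. ?g x)"
    by (simp add: sum.reindex[OF inj])
  also have "\<dots> \<le> (\<Sum>x\<in>Pow ?S \<times> ?V. ?g x)"
  proof (rule sum_mono2[OF _ range])
    fix x assume "x \<in> Pow ?S \<times> ?V - ?f ` nbr_sets Y"
    then obtain U V where "x = (U, V)" "U \<subseteq> A" "V \<subseteq> A"
      by auto
    then show "0 \<le> ?g x"
      using nonneg by (auto intro!: mult_nonneg_nonneg prod_nonneg)
  qed (use fin in auto)
  also have "\<dots> = (\<Sum>U\<in>Pow ?S. \<Prod>Z\<in>U. \<mu> Z) * (\<Sum>V\<in>?V. \<Prod>Z\<in>V. \<mu> Z)"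
    by (simp only: sum_product sum.cartesian_product)
  also have "(\<Sum>V\<in>?V. \<Prod>Z\<in>V. \<mu> Z) = 1 + (\<Sum>Z\<in>?W. \<mu> Z)"
    using fin by (subst sum.insert) (auto simp: sum.reindex)
  finally show ?thesis
    by (simp add: sum_prod_Pow[OF fin(1)])
qed

lemma sum_nbr_sets_le_exp:
  fixes \<mu> :: "'a \<Rightarrow> real"
  assumes nonneg: "\<And>Z. Z \<in> A \<Longrightarrow> 0 \<le> \<mu> Z"
  shows "(\<Sum>T\<in>nbr_sets Y. \<Prod>Z\<in>T. \<mu> Z) \<le> exp (\<Sum>Z\<in>{Z\<in>A. approx Z Y}. \<mu> Z)"
proof -
  let ?S = "{Z\<in>A. approx Z Y}"
  have fin: "finite ?S"
    using finite_A by simp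
  have "(\<Sum>T\<in>nbr_sets Y. \<Prod>Z\<in>T. \<mu> Z) \<le> (\<Sum>T\<in>Pow ?S. \<Prod>Z\<in>T. \<mu> Z)"
    using fin nonneg by (intro sum_mono2 prod_nonneg) (auto simp: nbr_sets_def)
  also have "\<dots> = (\<Prod>Z\<in>?S. 1 + \<mu> Z)"
    by (rule sum_prod_Pow[OF fin])
  also have "\<dots> \<le> exp (\<Sum>Z\<in>?S. \<mu> Z)"
    unfolding exp_sum[OF fin] using nonneg by (intro prod_mono) auto
  finally show ?thesis .
qed

end

context pra_setting
begin

lemma nbr_sets_eq: "nbr_sets Y = neighbor_sets n F \<B> Y"
  by (simp add: nbr_sets_def neighbor_sets_def rel_approx_def)

lemma pra_correct_of_weights:
  assumes nonneg: "\<And>Y. Y \<in> atomic_sets n F \<Longrightarrow> 0 \<le> \<mu> Y"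
    and mu: "\<And>Y. Y \<in> atomic_sets n F \<Longrightarrow> vpow p Y * Q Y * (\<Sum>T\<in>nbr_sets Y. \<Prod>Z\<in>T. \<mu> Z) \<le> \<mu> Y"
  shows "as_terminates_avoiding \<B> (pra n F p Q \<B> sel) \<and>
    expected_resamplings (pra n F p Q \<B> sel) \<le> ennreal (\<Sum>Y\<in>atomic_sets n F. \<mu> Y)"
proof (intro pra_correct_of_cost expected_cost_le)
  fix m
  have "ennreal (vpow p Y * Q Y) * (\<Sum>T\<in>nbr_sets Y. \<Prod>Z\<in>T. ennreal (\<mu> Z)) \<le> ennreal (\<mu> Y)"
    if Y: "Y \<in> atomic_sets n F" for Y
  proof -
    have T: "0 \<le> \<mu> Z" if "Z \<in> T" "T \<in> nbr_sets Y" for Z T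
      using that nonneg by (auto simp: nbr_sets_def)
    have "(\<Sum>T\<in>nbr_sets Y. \<Prod>Z\<in>T. ennreal (\<mu> Z)) = (\<Sum>T\<in>nbr_sets Y. ennreal (\<Prod>Z\<in>T. \<mu> Z))"
      using T by (intro sum.cong refl prod_ennreal) auto
    also have "\<dots> = ennreal (\<Sum>T\<in>nbr_sets Y. \<Prod>Z\<in>T. \<mu> Z)"
      using T by (intro sum_ennreal prod_nonneg) auto
    finally have "ennreal (vpow p Y * Q Y) * (\<Sum>T\<in>nbr_sets Y. \<Prod>Z\<in>T. ennreal (\<mu> Z))
        = ennreal (vpow p Y * Q Y * (\<Sum>T\<in>nbr_sets Y. \<Prod>Z\<in>T. \<mu> Z))"
      using vpow_nonneg[OF Y] Q_nonneg[OF Y] by (simp add: ennreal_mult')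
    then show ?thesis
      using mu[OF Y] by (simp add: ennreal_leI)
  qed
  then have "(\<integral>\<^sup>+X. \<integral>\<^sup>+Ys. of_nat (length Ys) \<partial>measure_pmf (run m X []) \<partial>measure_pmf (initial_pmf n F p))
      \<le> (\<Sum>Y\<in>atomic_sets n F. ennreal (\<mu> Y))"
    by (rule expected_run_length_le)
  also have "\<dots> = ennreal (\<Sum>Y\<in>atomic_sets n F. \<mu> Y)"
    using nonneg by (rule sum_ennreal)
  finally show "(\<integral>\<^sup>+X. \<integral>\<^sup>+Ys. of_nat (length Ys) \<partial>measure_pmf (run m X []) \<partial>measure_pmf (initial_pmf n F p))
      \<le> ennreal (\<Sum>Y\<in>atomic_sets n F. \<mu> Y)" .
qed

lemma pra_correct_of_cluster_expansion:
  assumes nonneg: "\<And>Y. Y \<in> atomic_sets n F \<Longrightarrow> 0 \<le> \<mu> Y"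
    and mu: "\<And>Y. Y \<in> atomic_sets n F \<Longrightarrow>
      vpow p Y * Q Y * (\<Prod>Z\<in>{Z\<in>atomic_sets n F. rel_sim Z Y}. 1 + \<mu> Z)
        * (1 + (\<Sum>Z\<in>{Z\<in>atomic_sets n F. rel_bowtie \<B> Z Y}. \<mu> Z)) \<le> \<mu> Y"
  shows "as_terminates_avoiding \<B> (pra n F p Q \<B> sel) \<and>
    expected_resamplings (pra n F p Q \<B> sel) \<le> ennreal (\<Sum>Y\<in>atomic_sets n F. \<mu> Y)"
proof (rule pra_correct_of_weights[OF nonneg])
  fix Y assume Y: "Y \<in> atomic_sets n F"
  have "vpow p Y * Q Y * (\<Sum>T\<in>nbr_sets Y. \<Prod>Z\<in>T. \<mu> Z)
      \<le> vpow p Y * Q Y * ((\<Prod>Z\<in>{Z\<in>atomic_sets n F. rel_sim Z Y}. 1 + \<mu> Z)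
        * (1 + (\<Sum>Z\<in>{Z\<in>atomic_sets n F. rel_bowtie \<B> Z Y}. \<mu> Z)))"
    using vpow_nonneg[OF Y] Q_nonneg[OF Y] nonneg by (intro mult_left_mono sum_nbr_sets_le_split) auto
  with mu[OF Y] show "vpow p Y * Q Y * (\<Sum>T\<in>nbr_sets Y. \<Prod>Z\<in>T. \<mu> Z) \<le> \<mu> Y"
    by (simp add: mult.assoc)
qed

text \<open>
  With \<open>\<mu>(Y) = e p\<^sup>Y Q(Y)\<close>, unsupported sets have weight zero, and the at most \<open>D\<close> supported neighbors
  have total weight at most \<open>e P D \<le> 1\<close>; so the sum over neighbor-sets is at most \<open>e\<close>.
\<close>

lemma pra_correct_of_symmetric:
  fixes P D :: real
  assumes P: "\<And>Y. Y \<in> atomic_sets n F \<Longrightarrow> vpow p Y * Q Y \<le> P"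
    and D: "\<And>Y. Y \<in> supported n F Q \<Longrightarrow> real (card {Z\<in>supported n F Q. rel_approx \<B> Z Y}) \<le> D"
    and ePD: "exp 1 * P * D \<le> 1"
  shows "as_terminates_avoiding \<B> (pra n F p Q \<B> sel) \<and>
    expected_resamplings (pra n F p Q \<B> sel)
      \<le> ennreal (exp 1 * (\<Sum>Y\<in>atomic_sets n F. vpow p Y * Q Y))"
proof -
  define \<mu> where "\<mu> Y = exp 1 * (vpow p Y * Q Y)" for Y
  have nonneg: "0 \<le> \<mu> Y" if "Y \<in> atomic_sets n F" for Y
    using vpow_nonneg[OF that] Q_nonneg[OF that] by (simp add: \<mu>_def)
  have "vpow p Y * Q Y * (\<Sum>T\<in>nbr_sets Y. \<Prod>Z\<in>T. \<mu> Z) \<le> \<mu> Y" if Y: "Y \<in> atomic_sets n F" for Y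
  proof (cases "Q Y = 0")
    case False
    then have sY: "Y \<in> supported n F Q"
      using Y Q_nonneg[OF Y] by (simp add: supported_def)
    let ?N = "{Z\<in>atomic_sets n F. approx Z Y}" and ?S = "{Z\<in>supported n F Q. rel_approx \<B> Z Y}"
    have P0: "0 \<le> P"
      using P[OF Y] vpow_nonneg[OF Y] Q_nonneg[OF Y] by (smt (verit) mult_nonneg_nonneg)
    have "\<mu> Z = 0" if "Z \<in> ?N - ?S" for Z
    proof -
      have "Q Z = 0"
        using that Q_nonneg[of Z] by (auto simp: supported_def rel_approx_def)
      then show ?thesis by (simp add: \<mu>_def)
    qed
    then have "(\<Sum>Z\<in>?N. \<mu> Z) = (\<Sum>Z\<in>?S. \<mu> Z)"
      using finite_A by (intro sum.mono_neutral_right) (auto simp: supported_def rel_approx_def)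
    also have "\<dots> \<le> (\<Sum>Z\<in>?S. exp 1 * P)"
      using P by (intro sum_mono) (auto simp: \<mu>_def supported_def)
    also have "\<dots> = exp 1 * P * real (card ?S)"
      by simp
    also have "\<dots> \<le> exp 1 * P * D"
      using D[OF sY] P0 by (intro mult_left_mono) auto
    finally have "exp (\<Sum>Z\<in>?N. \<mu> Z) \<le> exp 1"
      using ePD by simp
    moreover have "(\<Sum>T\<in>nbr_sets Y. \<Prod>Z\<in>T. \<mu> Z) \<le> exp (\<Sum>Z\<in>?N. \<mu> Z)"
      by (rule sum_nbr_sets_le_exp) (rule nonneg)
    ultimately have "(\<Sum>T\<in>nbr_sets Y. \<Prod>Z\<in>T. \<mu> Z) \<le> exp 1"
      by linarith
    then have "vpow p Y * Q Y * (\<Sum>T\<in>nbr_sets Y. \<Prod>Z\<in>T. \<mu> Z) \<le> vpow p Y * Q Y * exp 1"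
      using vpow_nonneg[OF Y] Q_nonneg[OF Y] by (intro mult_left_mono) auto
    then show ?thesis
      by (simp add: \<mu>_def mult.commute)
  qed (simp add: \<mu>_def)
  then show ?thesis
    using pra_correct_of_weights[of \<mu>] nonneg by (simp add: \<mu>_def sum_distrib_left)
qed

end

theorem theorem2p6:
  fixes n :: nat
    and F :: "nat \<Rightarrow> 'v set"
    and p :: "'v elem \<Rightarrow> real"
    and Q :: "'v elem set \<Rightarrow> real"
    and \<B> :: "'v elem set set"
    and sel :: "'v selector"
  assumes "\<And>i. i \<in> {1..n} \<Longrightarrow> finite (F i)"
    and "\<B> \<subseteq> atomic_sets n F"
    and "fractional_hitting_set n F \<B> Q"
    and "probability_vector n F p"
    and "valid_selector \<B> sel"
  shows
    "(\<forall>\<mu> :: 'v elem set \<Rightarrow> real.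
        (\<forall>Y\<in>atomic_sets n F. 0 \<le> \<mu> Y) \<and>
        (\<forall>Y\<in>atomic_sets n F.
           \<mu> Y \<ge> vpow p Y * Q Y * (\<Sum>T\<in>neighbor_sets n F \<B> Y. \<Prod>Y'\<in>T. \<mu> Y')) \<longrightarrow>
        as_terminates_avoiding \<B> (pra n F p Q \<B> sel) \<and>
        expected_resamplings (pra n F p Q \<B> sel) \<le> ennreal (\<Sum>Y\<in>atomic_sets n F. \<mu> Y)) \<and>
     (\<forall>\<mu> :: 'v elem set \<Rightarrow> real.
        (\<forall>Y\<in>atomic_sets n F. 0 \<le> \<mu> Y) \<and>
        (\<forall>Y\<in>atomic_sets n F.
           \<mu> Y \<ge> vpow p Y * Q Y
             * (\<Prod>Y'\<in>{Y'\<in>atomic_sets n F. rel_sim Y' Y}. 1 + \<mu> Y')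
             * (1 + (\<Sum>Y''\<in>{Y''\<in>atomic_sets n F. rel_bowtie \<B> Y'' Y}. \<mu> Y''))) \<longrightarrow>
        as_terminates_avoiding \<B> (pra n F p Q \<B> sel) \<and>
        expected_resamplings (pra n F p Q \<B> sel) \<le> ennreal (\<Sum>Y\<in>atomic_sets n F. \<mu> Y)) \<and>
     (\<forall>P D :: real.
        (\<forall>Y\<in>atomic_sets n F. vpow p Y * Q Y \<le> P) \<and>
        (\<forall>Y\<in>supported n F Q. real (card {Y'\<in>supported n F Q. rel_approx \<B> Y' Y}) \<le> D) \<and>
        exp 1 * P * D \<le> 1 \<longrightarrow>
        as_terminates_avoiding \<B> (pra n F p Q \<B> sel) \<and>
        expected_resamplings (pra n F p Q \<B> sel)
          \<le> ennreal (exp 1 * (\<Sum>Y\<in>atomic_sets n F. vpow p Y * Q Y)))"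
proof -
  interpret pra_setting n F p Q \<B> sel
    by unfold_locales (use assms in auto)
  show ?thesis
    using pra_correct_of_weights pra_correct_of_cluster_expansion pra_correct_of_symmetric
    unfolding nbr_sets_eq by blast
qed

end
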